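(* Let $(\mathfrak M,\Phi,\varphi)$ be a quantum dynamical system with $\varphi$-adjoint $\Phi^\sharp$, and let $\mathfrak D_\infty=\bigcap_{k\in\mathbb Z}\mathfrak D_{\Phi_k}$. If $\mathfrak D_\infty=\mathbb C1$, then the normal state $\varphi$ is of asymptotic equilibrium, i.e. $\lim_{n\to+\infty}\omega(\Phi^n(a))=\omega(1)\varphi(a)$ for all $a\in\mathfrak M$ and all $\omega\in\mathfrak M_*$, and the quantum dynamical system $(\mathfrak M,\Phi,\varphi)$ is ergodic.
   Context: A unital Schwartz map on a von Neumann algebra $\mathfrak M$ is an ultraweakly continuous linear map $\Phi:\mathfrak M\to\mathfrak M$ with $\Phi(1)=1$ and $0\le\Phi(a^* )\Phi(a)\le\Phi(a^*a)$ for all $a\in\mathfrak M$. A quantum dynamical system $(\mathfrak M,\Phi,\varphi)$ consists of a von Neumann algebra $\mathfrak M$ (with predual $\mathfrak M_*$), a unital Schwartz map $\Phi$ on $\mathfrak M$, and a normal faithful state $\varphi$ on $\mathfrak M$ with $\varphi\circ\Phi=\varphi$, such that $\Phi$ admits a $\varphi$-adjoint, i.e. a normal unital Schwartz map $\Phi^\sharp:\mathfrak M\to\mathfrak M$ with $\varphi(b\Phi(a))=\varphi(\Phi^\sharp(b)a)$ for all $a,b\in\mathfrak M$. For a unital Schwartz map $\Psi$, its multiplicative domain is $\mathfrak D_\Psi=\{a\in\mathfrak M:\Psi(a^*a)=\Psi(a^* )\Psi(a)\text{ and }\Psi(aa^* )=\Psi(a)\Psi(a^* )\}$, a von Neumann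 algebra. For $k\in\mathbb Z$, $\Phi_k=\Phi^k$ if $k\ge0$ and $\Phi_k=(\Phi^\sharp)^{|k|}$ if $k<0$. $(\mathfrak M,\Phi,\varphi)$ is ergodic if for all $a,b\in\mathfrak M$, $\lim_{N\to\infty}\frac1{N+1}\sum_{k=0}^N[\varphi(a\Phi^k(b))-\varphi(a)\varphi(b)]=0$. *)

theory Defs
  imports "HOL-Analysis.Analysis"
begin

class scaleC =
  fixes scaleC :: "complex \<Rightarrow> 'a \<Rightarrow> 'a"  (infixr "*\<^sub>C" 75)

text \<open>The inner product is conjugate-linear in its first argument. Since
  \<open>inner\<close> is the real part of \<open>cinner\<close>, the norm inherited from
  \<^class>\<open>real_inner\<close> is the Hilbert space norm, and positive definiteness is
  inherited as well.\<close>

class chilbert_space = real_inner + complete_space + scaleC +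
  fixes cinner :: "'a \<Rightarrow> 'a \<Rightarrow> complex"
  assumes scaleC_add_right: "c *\<^sub>C (x + y) = c *\<^sub>C x + c *\<^sub>C y"
    and scaleC_add_left: "(c + d) *\<^sub>C x = c *\<^sub>C x + d *\<^sub>C x"
    and scaleC_scaleC: "c *\<^sub>C (d *\<^sub>C x) = (c * d) *\<^sub>C x"
    and scaleC_of_real: "complex_of_real r *\<^sub>C x = r *\<^sub>R x"
    and cinner_commute: "cinner x y = cnj (cinner y x)"
    and cinner_add_right: "cinner x (y + z) = cinner x y + cinner x z"
    and cinner_scaleC_right: "cinner x (c *\<^sub>C y) = c * cinner x y"
    and inner_eq_Re_cinner: "inner x y = Re (cinner x y)"

lemma norm_scaleC: "norm (c *\<^sub>C x) = cmod c * norm x"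
  for x :: "'a::chilbert_space"
proof -
  have "cinner (c *\<^sub>C x) x = cnj c * cinner x x"
    by (metis cinner_commute cinner_scaleC_right complex_cnj_mult)
  then have "cinner (c *\<^sub>C x) (c *\<^sub>C x) = complex_of_real ((cmod c)\<^sup>2) * cinner x x"
    by (simp add: cinner_scaleC_right complex_norm_square mult.assoc del: of_real_power)
  then have "(norm (c *\<^sub>C x))\<^sup>2 = (cmod c * norm x)\<^sup>2"
    by (simp add: power2_norm_eq_inner inner_eq_Re_cinner power_mult_distrib)
  then show ?thesis
    by (simp add: power2_eq_iff_nonneg)
qed

lemma bounded_linear_scaleC: "bounded_linear (\<lambda>x::'a::chilbert_space. c *\<^sub>C x)"
proof (rule bounded_linear_intro)
  show "c *\<^sub>C (r *\<^sub>R x) = r *\<^sub>R (c *\<^sub>C x)" for r and x :: 'a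
    by (simp add: scaleC_of_real [symmetric] scaleC_scaleC mult.commute)
  show "norm (c *\<^sub>C x) \<le> norm x * cmod c" for x :: 'a
    by (simp add: norm_scaleC)
qed (rule scaleC_add_right)

instantiation complex :: chilbert_space
begin
definition "scaleC c x = c * (x::complex)"
definition "cinner x y = cnj x * (y::complex)"
instance
  by standard (auto simp: scaleC_complex_def cinner_complex_def algebra_simps
      scaleR_conv_of_real inner_complex_def)
end

instantiation blinfun :: (real_normed_vector, chilbert_space) scaleC
begin
lift_definition scaleC_blinfun :: "complex \<Rightarrow> 'a \<Rightarrow>\<^sub>L 'b \<Rightarrow> 'a \<Rightarrow>\<^sub>L 'b"
  is "\<lambda>c a x. c *\<^sub>C a x"
  by (rule bounded_linear_compose [OF bounded_linear_scaleC])
instance ..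
end

text \<open>The type \<open>'h \<Rightarrow>\<^sub>L 'h\<close> contains all bounded real-linear operators; the
  complex-linear ones among them form the algebra of bounded operators on \<open>'h\<close>.\<close>

definition bounded_ops :: "('h::chilbert_space \<Rightarrow>\<^sub>L 'h) set" where
  "bounded_ops = {a. \<forall>c x. blinfun_apply a (c *\<^sub>C x) = c *\<^sub>C blinfun_apply a x}"

text \<open>For \<open>a \<in> bounded_ops\<close> the adjoint exists and is unique by the Riesz
  representation theorem; for other arguments it is unspecified.\<close>

definition adj :: "('h::chilbert_space \<Rightarrow>\<^sub>L 'h) \<Rightarrow> ('h \<Rightarrow>\<^sub>L 'h)" where
  "adj a = (THE b. \<forall>x y. cinner (blinfun_apply a x) y = cinner x (blinfun_apply b y))"

definition positive_op :: "('h::chilbert_space \<Rightarrow>\<^sub>L 'h) \<Rightarrow> bool" where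
  "positive_op a \<longleftrightarrow>
     a \<in> bounded_ops \<and>
     (\<forall>x. cinner x (blinfun_apply a x) \<in> \<real> \<and> 0 \<le> Re (cinner x (blinfun_apply a x)))"

definition op_le :: "('h::chilbert_space \<Rightarrow>\<^sub>L 'h) \<Rightarrow> ('h \<Rightarrow>\<^sub>L 'h) \<Rightarrow> bool" where
  "op_le a b \<longleftrightarrow> positive_op (b - a)"

definition commutant :: "('h::chilbert_space \<Rightarrow>\<^sub>L 'h) set \<Rightarrow> ('h \<Rightarrow>\<^sub>L 'h) set" where
  "commutant S = {b \<in> bounded_ops. \<forall>a\<in>S. a o\<^sub>L b = b o\<^sub>L a}"

text \<open>That a self-adjoint set of operators equal to its bicommutant is a unital
  subalgebra is automatic.\<close>

definition von_neumann_algebra :: "('h::chilbert_space \<Rightarrow>\<^sub>L 'h) set \<Rightarrow> bool" where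
  "von_neumann_algebra M \<longleftrightarrow>
     M \<subseteq> bounded_ops \<and> (\<forall>a\<in>M. adj a \<in> M) \<and> commutant (commutant M) = M"

definition square_summable :: "(nat \<Rightarrow> 'h::chilbert_space) \<Rightarrow> bool" where
  "square_summable \<xi> \<longleftrightarrow> summable (\<lambda>n. (norm (\<xi> n))\<^sup>2)"

text \<open>The weakest topology on the bounded operators making
  \<open>a \<mapsto> \<Sum>n. \<langle>\<xi> n, a (\<eta> n)\<rangle>\<close> continuous for all square-summable \<open>\<xi>\<close>, \<open>\<eta>\<close>.\<close>

definition ultraweak_topology :: "('h::chilbert_space \<Rightarrow>\<^sub>L 'h) topology" where
  "ultraweak_topology = topology_generated_by
     {{a \<in> bounded_ops. (\<Sum>n. cinner (\<xi> n) (blinfun_apply a (\<eta> n))) \<in> U} | \<xi> \<eta> U.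
        square_summable \<xi> \<and> square_summable \<eta> \<and> open U}"

definition predual :: "('h::chilbert_space \<Rightarrow>\<^sub>L 'h) set \<Rightarrow> (('h \<Rightarrow>\<^sub>L 'h) \<Rightarrow> complex) set" where
  "predual M = {\<omega>.
     (\<forall>a\<in>M. \<forall>b\<in>M. \<omega> (a + b) = \<omega> a + \<omega> b) \<and>
     (\<forall>c. \<forall>a\<in>M. \<omega> (c *\<^sub>C a) = c * \<omega> a) \<and>
     continuous_map (subtopology ultraweak_topology M) euclidean \<omega>}"

definition normal_faithful_state ::
    "('h::chilbert_space \<Rightarrow>\<^sub>L 'h) set \<Rightarrow> (('h \<Rightarrow>\<^sub>L 'h) \<Rightarrow> complex) \<Rightarrow> bool" where
  "normal_faithful_state M \<phi> \<longleftrightarrow>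
     \<phi> \<in> predual M \<and>
     (\<forall>a\<in>M. positive_op a \<longrightarrow> \<phi> a \<in> \<real> \<and> 0 \<le> Re (\<phi> a)) \<and>
     \<phi> id_blinfun = 1 \<and>
     (\<forall>a\<in>M. positive_op a \<longrightarrow> \<phi> a = 0 \<longrightarrow> a = 0)"

text \<open>Maps on \<open>M\<close> are functions on the whole operator type of which only the
  restriction to \<open>M\<close> matters.\<close>

definition unital_schwartz_map ::
    "('h::chilbert_space \<Rightarrow>\<^sub>L 'h) set \<Rightarrow> (('h \<Rightarrow>\<^sub>L 'h) \<Rightarrow> ('h \<Rightarrow>\<^sub>L 'h)) \<Rightarrow> bool" where
  "unital_schwartz_map M \<Phi> \<longleftrightarrow>
     (\<forall>a\<in>M. \<Phi> a \<in> M) \<and>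
     (\<forall>a\<in>M. \<forall>b\<in>M. \<Phi> (a + b) = \<Phi> a + \<Phi> b) \<and>
     (\<forall>c. \<forall>a\<in>M. \<Phi> (c *\<^sub>C a) = c *\<^sub>C \<Phi> a) \<and>
     continuous_map (subtopology ultraweak_topology M) (subtopology ultraweak_topology M) \<Phi> \<and>
     \<Phi> id_blinfun = id_blinfun \<and>
     (\<forall>a\<in>M. op_le 0 (\<Phi> (adj a) o\<^sub>L \<Phi> a) \<and>
            op_le (\<Phi> (adj a) o\<^sub>L \<Phi> a) (\<Phi> (adj a o\<^sub>L a)))"

definition is_state_adjoint ::
    "('h::chilbert_space \<Rightarrow>\<^sub>L 'h) set \<Rightarrow> (('h \<Rightarrow>\<^sub>L 'h) \<Rightarrow> complex) \<Rightarrow>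
     (('h \<Rightarrow>\<^sub>L 'h) \<Rightarrow> ('h \<Rightarrow>\<^sub>L 'h)) \<Rightarrow> (('h \<Rightarrow>\<^sub>L 'h) \<Rightarrow> ('h \<Rightarrow>\<^sub>L 'h)) \<Rightarrow> bool" where
  "is_state_adjoint M \<phi> \<Phi> \<Phi>s \<longleftrightarrow>
     unital_schwartz_map M \<Phi>s \<and>
     (\<forall>a\<in>M. \<forall>b\<in>M. \<phi> (b o\<^sub>L \<Phi> a) = \<phi> (\<Phi>s b o\<^sub>L a))"

definition quantum_dynamical_system ::
    "('h::chilbert_space \<Rightarrow>\<^sub>L 'h) set \<Rightarrow> (('h \<Rightarrow>\<^sub>L 'h) \<Rightarrow> ('h \<Rightarrow>\<^sub>L 'h)) \<Rightarrow>
     (('h \<Rightarrow>\<^sub>L 'h) \<Rightarrow> complex) \<Rightarrow> bool" where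
  "quantum_dynamical_system M \<Phi> \<phi> \<longleftrightarrow>
     von_neumann_algebra M \<and>
     unital_schwartz_map M \<Phi> \<and>
     normal_faithful_state M \<phi> \<and>
     (\<forall>a\<in>M. \<phi> (\<Phi> a) = \<phi> a) \<and>
     (\<exists>\<Phi>s. is_state_adjoint M \<phi> \<Phi> \<Phi>s)"

definition multiplicative_domain ::
    "('h::chilbert_space \<Rightarrow>\<^sub>L 'h) set \<Rightarrow> (('h \<Rightarrow>\<^sub>L 'h) \<Rightarrow> ('h \<Rightarrow>\<^sub>L 'h)) \<Rightarrow> ('h \<Rightarrow>\<^sub>L 'h) set" where
  "multiplicative_domain M \<Psi> =
     {a \<in> M. \<Psi> (adj a o\<^sub>L a) = \<Psi> (adj a) o\<^sub>L \<Psi> a \<and> \<Psi> (a o\<^sub>L adj a) = \<Psi> a o\<^sub>L \<Psi> (adj a)}"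

definition int_iterate :: "('a \<Rightarrow> 'a) \<Rightarrow> ('a \<Rightarrow> 'a) \<Rightarrow> int \<Rightarrow> ('a \<Rightarrow> 'a)" where
  "int_iterate \<Phi> \<Phi>s k = (if k \<ge> 0 then \<Phi> ^^ nat k else \<Phi>s ^^ nat \<bar>k\<bar>)"

definition D_infinity ::
    "('h::chilbert_space \<Rightarrow>\<^sub>L 'h) set \<Rightarrow> (('h \<Rightarrow>\<^sub>L 'h) \<Rightarrow> ('h \<Rightarrow>\<^sub>L 'h)) \<Rightarrow>
     (('h \<Rightarrow>\<^sub>L 'h) \<Rightarrow> ('h \<Rightarrow>\<^sub>L 'h)) \<Rightarrow> ('h \<Rightarrow>\<^sub>L 'h) set" where
  "D_infinity M \<Phi> \<Phi>s = (\<Inter>k::int. multiplicative_domain M (int_iterate \<Phi> \<Phi>s k))"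

definition asymptotic_equilibrium ::
    "('h::chilbert_space \<Rightarrow>\<^sub>L 'h) set \<Rightarrow> (('h \<Rightarrow>\<^sub>L 'h) \<Rightarrow> ('h \<Rightarrow>\<^sub>L 'h)) \<Rightarrow>
     (('h \<Rightarrow>\<^sub>L 'h) \<Rightarrow> complex) \<Rightarrow> bool" where
  "asymptotic_equilibrium M \<Phi> \<phi> \<longleftrightarrow>
     (\<forall>a\<in>M. \<forall>\<omega>\<in>predual M. (\<lambda>n. \<omega> ((\<Phi> ^^ n) a)) \<longlonglongrightarrow> \<omega> id_blinfun * \<phi> a)"

definition ergodic ::
    "('h::chilbert_space \<Rightarrow>\<^sub>L 'h) set \<Rightarrow> (('h \<Rightarrow>\<^sub>L 'h) \<Rightarrow> ('h \<Rightarrow>\<^sub>L 'h)) \<Rightarrow>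
     (('h \<Rightarrow>\<^sub>L 'h) \<Rightarrow> complex) \<Rightarrow> bool" where
  "ergodic M \<Phi> \<phi> \<longleftrightarrow>
     (\<forall>a\<in>M. \<forall>b\<in>M.
        (\<lambda>N. 1 / (of_nat N + 1) * (\<Sum>k=0..N. \<phi> (a o\<^sub>L (\<Phi> ^^ k) b) - \<phi> a * \<phi> b))
          \<longlonglongrightarrow> 0)"

end

theory Submission
  imports Defs
begin

text \<open>
  In the GNS norm \<open>\<parallel>a\<parallel>\<^sub>\<phi>\<^sup>2 = \<phi>(a\<^sup>*a)\<close> the map \<open>\<Phi>\<close> is a contraction with adjoint \<open>\<Phi>\<^sup>\<sharp>\<close>. Hence
  \<open>\<parallel>\<Phi>\<^sup>n a\<parallel>\<^sub>\<phi>\<close> decreases to a limit, and the estimate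
  \<open>\<parallel>\<Phi>\<^sup>\<sharp>\<^sup>k \<Phi>\<^sup>k y - y\<parallel>\<^sub>\<phi>\<^sup>2 \<le> \<parallel>y\<parallel>\<^sub>\<phi>\<^sup>2 - \<parallel>\<Phi>\<^sup>k y\<parallel>\<^sub>\<phi>\<^sup>2\<close> for \<open>y = \<Phi>\<^sup>n a\<close> shows that every ultraweak
  cluster point \<open>b\<close> of the bounded sequence \<open>\<Phi>\<^sup>n a\<close> is fixed by \<open>\<Phi>\<^sup>\<sharp>\<^sup>k \<Phi>\<^sup>k\<close> and, likewise, by
  \<open>\<Phi>\<^sup>k \<Phi>\<^sup>\<sharp>\<^sup>k\<close>. Then \<open>\<Phi>\<^sup>k\<close> and \<open>\<Phi>\<^sup>\<sharp>\<^sup>k\<close> preserve the GNS norms of \<open>b\<close> and \<open>b\<^sup>*\<close>, so by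
  faithfulness of \<open>\<phi>\<close> equality holds in the Schwarz inequality, that is, \<open>b\<close> lies in every
  multiplicative domain. The hypothesis gives \<open>b = \<phi>(b)1 = \<phi>(a)1\<close>, and by compactness of bounded
  sets \<open>\<Phi>\<^sup>n a\<close> converges ultraweakly to \<open>\<phi>(a)1\<close>.
\<close>


subsection \<open>Complex Hilbert spaces\<close>

lemma cinner_add_left: "cinner (x + y) z = cinner x z + cinner y z"
  for x :: "'h::chilbert_space"
  by (metis cinner_commute cinner_add_right complex_cnj_add)

lemma cinner_scaleC_left: "cinner (c *\<^sub>C x) y = cnj c * cinner x y"
  for x :: "'h::chilbert_space"
  by (metis cinner_commute cinner_scaleC_right complex_cnj_mult)

lemma cinner_scaleR_right: "cinner x (r *\<^sub>R y) = of_real r * cinner x y"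
  for x :: "'h::chilbert_space"
  by (metis scaleC_of_real cinner_scaleC_right)

lemma cinner_zero_right [simp]: "cinner x 0 = 0" for x :: "'h::chilbert_space"
  using cinner_scaleR_right[of x 0 0] by simp


lemma cinner_zero_left [simp]: "cinner 0 x = 0" for x :: "'h::chilbert_space"
  by (metis cinner_zero_right cinner_commute complex_cnj_zero)

lemma cinner_minus_right: "cinner x (- y) = - cinner x y" for x :: "'h::chilbert_space"
  using cinner_scaleR_right[of x "-1" y] by simp

lemma cinner_diff_right: "cinner x (y - z) = cinner x y - cinner x z"
  for x :: "'h::chilbert_space"
  using cinner_add_right[of x y "- z"] by (simp add: cinner_minus_right)

lemma cinner_self: "cinner x x = complex_of_real ((norm x)\<^sup>2)" for x :: "'h::chilbert_space"
proof (rule complex_eqI)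
  show "Re (cinner x x) = Re (complex_of_real ((norm x)\<^sup>2))"
    by (simp add: power2_norm_eq_inner inner_eq_Re_cinner)
  have "Im (cinner x x) = Im (cnj (cinner x x))"
    using cinner_commute[of x x] by simp
  then show "Im (cinner x x) = Im (complex_of_real ((norm x)\<^sup>2))"
    by simp
qed

text \<open>Multiplying \<open>y\<close> by a unimodular scalar makes the inner product a
  nonnegative real, so the real Cauchy-Schwarz inequality applies.\<close>

lemma cinner_bound: "cmod (cinner x y) \<le> norm x * norm y" for x :: "'h::chilbert_space"
proof (cases "cinner x y = 0")
  case False
  define c where "c = cnj (sgn (cinner x y))"
  have c: "cmod c = 1"
    using False by (simp add: c_def norm_sgn)
  have "c * cinner x y = of_real (cmod (cinner x y))"
    using False complex_norm_square[of "cinner x y"]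
    by (simp add: c_def sgn_div_norm scaleR_conv_of_real field_simps power2_eq_square)
  then have "cmod (cinner x y) = Re (cinner x (c *\<^sub>C y))"
    by (simp add: cinner_scaleC_right)
  also have "\<dots> \<le> norm x * norm (c *\<^sub>C y)"
    using norm_cauchy_schwarz[of x "c *\<^sub>C y"] by (simp add: inner_eq_Re_cinner)
  finally show ?thesis
    by (simp add: norm_scaleC c)
qed simp

lemma cinner_right_eqI:
  fixes y :: "'h::chilbert_space"
  assumes "\<And>x. cinner x y = cinner x z"
  shows "y = z"
proof -
  have "cinner (y - z) (y - z) = 0"
    by (simp add: assms cinner_diff_right)
  then show ?thesis
    by (simp add: cinner_self)
qed

lemma scaleC_one: "1 *\<^sub>C x = x" for x :: "'h::chilbert_space"
  using scaleC_of_real[of 1 x] by simp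

text \<open>Riesz: a sequence on which the concave functional \<open>2 f x - \<parallel>x\<parallel>\<^sup>2\<close> approaches its
  supremum is Cauchy by the parallelogram law, and its limit represents \<open>f\<close>.\<close>

lemma riesz_real:
  fixes f :: "'h::{real_inner,complete_space} \<Rightarrow> real"
  assumes f: "bounded_linear f"
  shows "\<exists>z. \<forall>x. f x = inner x z"
proof -
  interpret f: bounded_linear f by fact
  define q where "q x = 2 * f x - (norm x)\<^sup>2" for x
  obtain K where K: "\<And>x. norm (f x) \<le> norm x * K"
    using f.bounded by blast
  have "q x \<le> K\<^sup>2" for x
  proof -
    have "2 * f x \<le> 2 * (norm x * K)"
      using K[of x] by simp
    also have "\<dots> \<le> (norm x)\<^sup>2 + K\<^sup>2"
      using sum_squares_bound[of "norm x" K] by simp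
    finally show ?thesis
      by (simp add: q_def)
  qed
  then have bdd: "bdd_above (range q)"
    by (intro bdd_aboveI[where M = "K\<^sup>2"]) auto
  define s where "s = (SUP x. q x)"
  have qs: "q x \<le> s" for x
    unfolding s_def by (rule cSUP_upper[OF _ bdd]) simp
  have "\<exists>x. s - 1 / real (Suc n) < q x" for n
  proof -
    have "s - 1 / real (Suc n) < s"
      by simp
    then show ?thesis
      unfolding s_def by (subst (asm) less_cSUP_iff[OF _ bdd]) (auto simp: s_def)
  qed
  then obtain X where X: "\<And>n. s - 1 / real (Suc n) < q (X n)"
    by metis
  have par: "(norm (x - y))\<^sup>2 \<le> 2 * ((s - q x) + (s - q y))" for x y
  proof -
    have "q ((1/2) *\<^sub>R (x + y)) = f x + f y - (norm (x + y))\<^sup>2 / 4"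
      unfolding q_def by (simp add: f.add f.scaleR power_divide)
    moreover have "(norm (x - y))\<^sup>2 = 2 * (norm x)\<^sup>2 + 2 * (norm y)\<^sup>2 - (norm (x + y))\<^sup>2"
      by (simp add: power2_norm_eq_inner inner_diff_left inner_diff_right inner_add_left inner_add_right inner_commute)
    ultimately show ?thesis
      using qs[of "(1/2) *\<^sub>R (x + y)"] by (simp add: q_def)
  qed
  have "Cauchy X"
  proof (rule metric_CauchyI)
    fix e :: real assume e: "0 < e"
    then obtain N where N: "4 / e\<^sup>2 < real N"
      using reals_Archimedean2 by blast
    have "dist (X m) (X n) < e" if "N \<le> m" "N \<le> n" for m n
    proof -
      have small: "1 / real (Suc k) < e\<^sup>2 / 4" if "N \<le> k" for k
      proof -
        have "4 / e\<^sup>2 < real (Suc k)"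
          using N that by simp
        then show ?thesis
          using e by (simp add: field_simps)
      qed
      have "(norm (X m - X n))\<^sup>2 < e\<^sup>2"
        using par[of "X m" "X n"] X[of m] X[of n] small[OF that(1)] small[OF that(2)] by simp
      then show ?thesis
        using e by (simp add: dist_norm power_less_imp_less_base)
    qed
    then show "\<exists>M. \<forall>m\<ge>M. \<forall>n\<ge>M. dist (X m) (X n) < e"
      by blast
  qed
  then obtain z where z: "X \<longlonglongrightarrow> z"
    using Cauchy_convergent convergent_def by blast
  have "(\<lambda>n. q (X n)) \<longlonglongrightarrow> q z"
    unfolding q_def by (intro tendsto_intros f.tendsto z)
  moreover have "(\<lambda>n. s - 1 / real (Suc n)) \<longlonglongrightarrow> s - 0"
    by (intro tendsto_diff tendsto_const LIMSEQ_Suc[OF lim_1_over_n])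
  ultimately have "s \<le> q z"
    using X by (intro LIMSEQ_le[where X = "\<lambda>n. s - 1 / real (Suc n)" and Y = "\<lambda>n. q (X n)"])
      (auto intro: less_imp_le)
  then have opt: "q y \<le> q z" for y
    using qs[of y] by simp
  have "f x = inner x z" for x
  proof -
    define d where "d = f x - inner x z"
    have ineq: "2 * t * d \<le> t\<^sup>2 * (norm x)\<^sup>2" for t
    proof -
      have "(norm (z + t *\<^sub>R x))\<^sup>2 = (norm z)\<^sup>2 + 2 * t * inner x z + t\<^sup>2 * (norm x)\<^sup>2"
        unfolding power2_norm_eq_inner
        by (simp add: inner_add_left inner_add_right inner_commute[of x z] power2_eq_square algebra_simps)
      then show ?thesis
        using opt[of "z + t *\<^sub>R x"] by (simp add: q_def f.add f.scaleR d_def algebra_simps)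
    qed
    \<comment> \<open>Adding 1 keeps the denominator positive when \<open>x = 0\<close>; the choice
      \<open>t = d / r\<close> then forces \<open>d\<^sup>2 \<le> 0\<close>.\<close>
    define r where "r = (norm x)\<^sup>2 + 1"
    have r: "r > 0"
      by (simp add: r_def add_nonneg_pos)
    have "2 * (d / r) * d \<le> (d / r)\<^sup>2 * r"
      using ineq[of "d / r"] by (rule order_trans) (simp add: r_def mult_left_mono)
    then have "2 * d\<^sup>2 / r \<le> d\<^sup>2 / r"
      using r by (simp add: power2_eq_square)
    then have "d\<^sup>2 \<le> 0"
      using r by (simp add: divide_le_cancel)
    then show ?thesis
      by (simp add: d_def)
  qed
  then show ?thesis
    by blast
qed

text \<open>For fixed \<open>y\<close> the real Riesz theorem represents \<open>Re (g x y)\<close>;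
  evaluating at \<open>\<i> *\<^sub>C x\<close> recovers the imaginary part. Uniqueness of the
  representing vector makes it linear in \<open>y\<close>.\<close>

lemma bounded_sesquilinear_form_representation:
  fixes g :: "'h::chilbert_space \<Rightarrow> 'h \<Rightarrow> complex"
  assumes addl: "\<And>x x' y. g (x + x') y = g x y + g x' y"
    and addr: "\<And>x y y'. g x (y + y') = g x y + g x y'"
    and scl: "\<And>c x y. g (c *\<^sub>C x) y = cnj c * g x y"
    and scr: "\<And>c x y. g x (c *\<^sub>C y) = c * g x y"
    and bound: "\<And>x y. cmod (g x y) \<le> C * norm x * norm y"
  shows "\<exists>b\<in>bounded_ops. \<forall>x y. g x y = cinner x (blinfun_apply b y)"
proof -
  have "\<exists>z. \<forall>x. g x y = cinner x z" for y
  proof -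
    have "bounded_linear (\<lambda>x. Re (g x y))"
    proof (rule bounded_linear_intro)
      show "Re (g (r *\<^sub>R x) y) = r *\<^sub>R Re (g x y)" for r x
        using scl[of "of_real r" x y] by (simp add: scaleC_of_real)
      show "norm (Re (g x y)) \<le> norm x * (C * norm y)" for x
        using bound[of x y] abs_Re_le_cmod[of "g x y"] by (simp add: mult_ac)
    qed (simp add: addl)
    then obtain z where z: "\<And>x. Re (g x y) = inner x z"
      using riesz_real by blast
    have "g x y = cinner x z" for x
    proof (rule complex_eqI)
      show "Re (g x y) = Re (cinner x z)"
        by (simp add: z inner_eq_Re_cinner)
      show "Im (g x y) = Im (cinner x z)"
        using z[of "\<i> *\<^sub>C x"] by (simp add: scl inner_eq_Re_cinner cinner_scaleC_left)
    qed
    then show ?thesis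
      by blast
  qed
  then obtain B where B: "\<And>x y. g x y = cinner x (B y)"
    by metis
  \<comment> \<open>The sign of \<open>C\<close> is unspecified, so the operator bound is stated
    with \<open>\<bar>C\<bar>\<close>.\<close>
  have C: "cmod (g x y) \<le> \<bar>C\<bar> * norm x * norm y" for x y
    using bound[of x y] by (rule order_trans) (intro mult_right_mono; simp)
  have "bounded_linear B"
  proof (rule bounded_linear_intro)
    show "B (x + y) = B x + B y" for x y
      by (rule cinner_right_eqI) (simp add: B[symmetric] addr cinner_add_right)
    show "B (r *\<^sub>R x) = r *\<^sub>R B x" for r x
      by (rule cinner_right_eqI)
        (metis B scr scaleC_of_real cinner_scaleR_right)
    show "norm (B x) \<le> norm x * \<bar>C\<bar>" for x
    proof (cases "norm (B x) = 0")
      case False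
      have "(norm (B x))\<^sup>2 \<le> \<bar>C\<bar> * norm (B x) * norm x"
        using C[of "B x" x] by (simp add: B cinner_self norm_power)
      then show ?thesis
        using False by (simp add: power2_eq_square mult_ac)
    qed simp
  qed
  then have app: "blinfun_apply (Blinfun B) = B"
    by (rule bounded_linear_Blinfun_apply)
  have "B (c *\<^sub>C x) = c *\<^sub>C B x" for c x
    by (rule cinner_right_eqI) (simp add: B[symmetric] scr cinner_scaleC_right)
  then show ?thesis
    using B app by (intro bexI[of _ "Blinfun B"]) (auto simp: bounded_ops_def)
qed

subsection \<open>Bounded operators and adjoints\<close>

lemma bounded_ops_scaleC: "a \<in> bounded_ops \<Longrightarrow> blinfun_apply a (c *\<^sub>C x) = c *\<^sub>C blinfun_apply a x"
  by (simp add: bounded_ops_def)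


lemma scaleC_blinfun_apply [simp]: "blinfun_apply (c *\<^sub>C a) x = c *\<^sub>C blinfun_apply a x"
  by (simp add: scaleC_blinfun.rep_eq)

lemma blinfun_eqI_cinner:
  fixes a b :: "'h::chilbert_space \<Rightarrow>\<^sub>L 'h"
  assumes "\<And>x y. cinner x (blinfun_apply a y) = cinner x (blinfun_apply b y)"
  shows "a = b"
  by (rule blinfun_eqI) (metis assms cinner_right_eqI)

lemma scaleC_blinfun_of_real:
  "complex_of_real r *\<^sub>C a = r *\<^sub>R a" for a :: "'h::chilbert_space \<Rightarrow>\<^sub>L 'h"
  by (rule blinfun_eqI) (simp add: scaleC_of_real blinfun.scaleR_left)

lemma scaleC_blinfun_minus1: "(- 1) *\<^sub>C a = - a" for a :: "'h::chilbert_space \<Rightarrow>\<^sub>L 'h"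
  using scaleC_blinfun_of_real[of "-1" a] by simp

lemma bounded_ops_add: "a \<in> bounded_ops \<Longrightarrow> b \<in> bounded_ops \<Longrightarrow> a + b \<in> bounded_ops"
  by (simp add: bounded_ops_def blinfun.add_left scaleC_add_right)

lemma bounded_ops_smult: "a \<in> bounded_ops \<Longrightarrow> c *\<^sub>C a \<in> bounded_ops"
  by (simp add: bounded_ops_def scaleC_scaleC mult.commute)

lemma bounded_ops_diff: "a \<in> bounded_ops \<Longrightarrow> b \<in> bounded_ops \<Longrightarrow> a - b \<in> bounded_ops"
  using bounded_ops_add[of a "(- 1) *\<^sub>C b"] bounded_ops_smult[of b "- 1"]
  by (simp add: scaleC_blinfun_minus1)

lemma bounded_ops_compose: "a \<in> bounded_ops \<Longrightarrow> b \<in> bounded_ops \<Longrightarrow> a o\<^sub>L b \<in> bounded_ops"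
  by (simp add: bounded_ops_def)

lemma bounded_ops_id: "id_blinfun \<in> bounded_ops"
  by (simp add: bounded_ops_def)

text \<open>The bounded sesquilinear form \<open>\<langle>a x, y\<rangle>\<close> is represented by
  an operator. This justifies the definite description in \<open>adj\<close>.\<close>

lemma adj_ex1:
  fixes a :: "'h::chilbert_space \<Rightarrow>\<^sub>L 'h"
  assumes a: "a \<in> bounded_ops"
  shows "\<exists>!b. \<forall>x y. cinner (blinfun_apply a x) y = cinner x (blinfun_apply b y)"
    and "\<exists>b\<in>bounded_ops. \<forall>x y. cinner (blinfun_apply a x) y = cinner x (blinfun_apply b y)"
proof -
  show ex: "\<exists>b\<in>bounded_ops. \<forall>x y. cinner (blinfun_apply a x) y = cinner x (blinfun_apply b y)"
  proof (rule bounded_sesquilinear_form_representation)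
    show "cmod (cinner (blinfun_apply a x) y) \<le> norm a * norm x * norm y" for x y
      by (rule order_trans[OF cinner_bound]) (intro mult_right_mono norm_blinfun norm_ge_zero)
  qed (simp_all add: a bounded_ops_scaleC blinfun.add_right cinner_add_left cinner_add_right
      cinner_scaleC_left cinner_scaleC_right)
  then show "\<exists>!b. \<forall>x y. cinner (blinfun_apply a x) y = cinner x (blinfun_apply b y)"
    by (metis blinfun_eqI_cinner)
qed

lemma cinner_adj:
  assumes "a \<in> bounded_ops"
  shows "cinner (blinfun_apply a x) y = cinner x (blinfun_apply (adj a) y)"
  using theI'[OF adj_ex1(1)[OF assms]] unfolding adj_def by blast

lemma adj_in_bounded_ops: "a \<in> bounded_ops \<Longrightarrow> adj a \<in> bounded_ops"
  using adj_ex1(2)[of a] cinner_adj[of a] by (metis blinfun_eqI_cinner)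

lemma cinner_adj':
  assumes "a \<in> bounded_ops"
  shows "cinner (blinfun_apply (adj a) x) y = cinner x (blinfun_apply a y)"
  by (metis assms cinner_adj cinner_commute)

lemma adj_eqI:
  assumes "a \<in> bounded_ops"
    and "\<And>x y. cinner (blinfun_apply a x) y = cinner x (blinfun_apply b y)"
  shows "adj a = b"
  by (rule blinfun_eqI_cinner) (metis assms cinner_adj)

lemma adj_adj: "a \<in> bounded_ops \<Longrightarrow> adj (adj a) = a"
  by (intro adj_eqI adj_in_bounded_ops cinner_adj')

lemma adj_add: "a \<in> bounded_ops \<Longrightarrow> b \<in> bounded_ops \<Longrightarrow> adj (a + b) = adj a + adj b"
  by (rule adj_eqI) (simp_all add: bounded_ops_add blinfun.add_left cinner_add_left cinner_add_right
      cinner_adj)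

lemma adj_smult: "a \<in> bounded_ops \<Longrightarrow> adj (c *\<^sub>C a) = cnj c *\<^sub>C adj a"
  by (rule adj_eqI) (simp_all add: bounded_ops_smult cinner_scaleC_left cinner_scaleC_right cinner_adj)

lemma adj_diff: "a \<in> bounded_ops \<Longrightarrow> b \<in> bounded_ops \<Longrightarrow> adj (a - b) = adj a - adj b"
  using adj_add[of a "(- 1) *\<^sub>C b"] adj_smult[of b "- 1"] bounded_ops_smult[of b "- 1"]
  by (simp add: scaleC_blinfun_minus1)

lemma adj_compose:
  "a \<in> bounded_ops \<Longrightarrow> b \<in> bounded_ops \<Longrightarrow> adj (a o\<^sub>L b) = adj b o\<^sub>L adj a"
  by (rule adj_eqI) (simp_all add: bounded_ops_compose cinner_adj)

lemma adj_id: "adj id_blinfun = id_blinfun"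
  by (rule adj_eqI) (simp_all add: bounded_ops_id)

text \<open>For \<open>z = a\<^sup>* y\<close> one has \<open>\<parallel>z\<parallel>\<^sup>2 =
  \<bar>\<langle>a z, y\<rangle>\<bar> \<le> \<parallel>a\<parallel> \<parallel>z\<parallel>
  \<parallel>y\<parallel>\<close>, and one factor cancels.\<close>

lemma norm_adj_le:
  assumes a: "a \<in> bounded_ops"
  shows "norm (adj a) \<le> norm a"
proof (rule norm_blinfun_bound)
  fix y
  let ?z = "blinfun_apply (adj a) y"
  have "(norm ?z)\<^sup>2 = cmod (cinner (blinfun_apply a ?z) y)"
    by (simp add: cinner_adj[OF a] cinner_self norm_power)
  also have "\<dots> \<le> norm a * norm ?z * norm y"
    by (rule order_trans[OF cinner_bound]) (intro mult_right_mono norm_blinfun norm_ge_zero)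
  finally show "norm ?z \<le> norm a * norm y"
    by (cases "norm ?z = 0") (simp_all add: power2_eq_square)
qed simp

lemma cinner_adj_compose_self:
  "a \<in> bounded_ops \<Longrightarrow>
    cinner x (blinfun_apply (adj a o\<^sub>L a) x) = complex_of_real ((norm (blinfun_apply a x))\<^sup>2)"
  by (simp add: cinner_adj[symmetric] cinner_self)

lemma positive_op_adj_compose: "a \<in> bounded_ops \<Longrightarrow> positive_op (adj a o\<^sub>L a)"
  unfolding positive_op_def
  by (simp only: cinner_adj_compose_self)
    (simp add: bounded_ops_compose adj_in_bounded_ops del: of_real_power)

text \<open>The quadratic form of \<open>a - a\<^sup>*\<close> vanishes; conclude by polarization.\<close>

lemma positive_op_self_adjoint:
  assumes "positive_op a"
  shows "adj a = a"
proof (rule adj_eqI)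
  show a: "a \<in> bounded_ops"
    using assms by (simp add: positive_op_def)
  define d where "d = a - adj a"
  have d: "d \<in> bounded_ops"
    by (simp add: d_def bounded_ops_diff a adj_in_bounded_ops)
  have q: "cinner x (blinfun_apply d x) = 0" for x
  proof -
    have "cinner x (blinfun_apply a x) \<in> \<real>"
      using assms by (simp add: positive_op_def)
    moreover have "cinner x (blinfun_apply (adj a) x) = cnj (cinner x (blinfun_apply a x))"
      by (metis a cinner_adj cinner_commute)
    ultimately show ?thesis
      by (simp add: d_def blinfun.diff_left cinner_diff_right Reals_cnj_iff)
  qed
  have "cinner x (blinfun_apply d y) = 0" for x y
  proof -
    have s: "cinner x (blinfun_apply d z) + cinner z (blinfun_apply d x) = 0" for z
      using q[of "x + z"] q[of x] q[of z]
      by (simp add: blinfun.add_right cinner_add_left cinner_add_right add.commute)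
    \<comment> \<open>Putting \<open>\<i> *\<^sub>C y\<close> for \<open>z\<close> changes the
      relative sign of the two terms; together with \<open>s\<close> at \<open>y\<close> this makes
      both vanish.\<close>
    have "\<i> * cinner x (blinfun_apply d y) - \<i> * cinner y (blinfun_apply d x) = 0"
      using s[of "\<i> *\<^sub>C y"] by (simp add: bounded_ops_scaleC[OF d] cinner_scaleC_right cinner_scaleC_left)
    then have "cinner x (blinfun_apply d y) = cinner y (blinfun_apply d x)"
      by (simp add: right_diff_distrib[symmetric])
    then show ?thesis
      using s[of y] by simp
  qed
  then have "d = 0"
    by (intro blinfun_eqI_cinner) simp
  then show "cinner (blinfun_apply a x) y = cinner x (blinfun_apply a y)" for x y
    using a by (simp add: d_def cinner_adj)
qed


subsection \<open>Bounded limits in the weak operator topology\<close>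

text \<open>The norm bound is built in because weak operator and ultraweak convergence agree on
  bounded sets. A general filter replaces subsequences, which need not converge for any choice when
  the space is not separable.\<close>

definition bounded_wot_limit ::
    "('i \<Rightarrow> 'h::chilbert_space \<Rightarrow>\<^sub>L 'h) \<Rightarrow> ('h \<Rightarrow>\<^sub>L 'h) \<Rightarrow> 'i filter \<Rightarrow> bool" where
  "bounded_wot_limit f b F \<longleftrightarrow>
     (\<forall>i. f i \<in> bounded_ops) \<and> b \<in> bounded_ops \<and> (\<exists>C. \<forall>i. norm (f i) \<le> C) \<and>
     (\<forall>x y. ((\<lambda>i. cinner x (blinfun_apply (f i) y)) \<longlongrightarrow> cinner x (blinfun_apply b y)) F)"

lemma bounded_wot_limit_compose_left:
  assumes "bounded_wot_limit f b F" and c: "c \<in> bounded_ops"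
  shows "bounded_wot_limit (\<lambda>i. c o\<^sub>L f i) (c o\<^sub>L b) F"
proof -
  obtain C where C: "\<And>i. norm (f i) \<le> C"
    using assms(1) unfolding bounded_wot_limit_def by blast
  have "norm (c o\<^sub>L f i) \<le> norm c * C" for i
    by (rule order_trans[OF norm_blinfun_compose]) (intro mult_left_mono C norm_ge_zero)
  then show ?thesis
    using assms by (auto simp: bounded_wot_limit_def bounded_ops_compose cinner_adj'[symmetric])
qed


section \<open>Comparison with the ultraweak topology\<close>

lemma topspace_ultraweak_topology: "topspace ultraweak_topology = bounded_ops"
proof -
  have "bounded_ops \<in> {{a \<in> bounded_ops. (\<Sum>n. cinner (\<xi> n) (blinfun_apply a (\<eta> n))) \<in> U} | \<xi> \<eta> U.
        square_summable (\<xi> :: nat \<Rightarrow> 'a) \<and> square_summable \<eta> \<and> open U}"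
    \<comment> \<open>Zero sequences and \<open>U = UNIV\<close> make all of
      \<open>bounded_ops\<close> a generator.\<close>
    by (rule CollectI, rule exI[of _ "\<lambda>_. 0"], rule exI[of _ "\<lambda>_. 0"], rule exI[of _ UNIV])
      (simp add: square_summable_def)
  then show ?thesis
    unfolding ultraweak_topology_def topology_generated_by_topspace by blast
qed

text \<open>On bounded sets the series defining the ultraweak topology converge uniformly.\<close>

lemma bounded_wot_limit_imp_limitin_ultraweak:
  assumes f: "bounded_wot_limit f b F"
  shows "limitin ultraweak_topology f b F"
proof (cases "F = bot")
  case False
  obtain C where C: "\<And>i. norm (f i) \<le> C"
    using f unfolding bounded_wot_limit_def by blast
  \<comment> \<open>Induction over the generation of the topology leaves only the subbasic sets to
    be analysed.\<close>
  have "eventually (\<lambda>i. f i \<in> U) F"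
    if "generate_topology_on {{a \<in> bounded_ops. (\<Sum>n. cinner (\<xi> n) (blinfun_apply a (\<eta> n))) \<in> U} | \<xi> \<eta> U.
        square_summable \<xi> \<and> square_summable \<eta> \<and> open U} U" "b \<in> U" for U
    using that
  proof induction
    case (Basis S)
    then obtain \<xi> \<eta> V where
      S: "S = {a \<in> bounded_ops. (\<Sum>n. cinner (\<xi> n) (blinfun_apply a (\<eta> n))) \<in> V}"
      and sq: "square_summable \<xi>" "square_summable \<eta>" and V: "open V"
      by blast
    \<comment> \<open>A summable majorant independent of \<open>i\<close>, obtained from
      \<open>2 s t \<le> s\<^sup>2 + t\<^sup>2\<close>, as Tannery's theorem (dominated convergence
      for series) requires.\<close>
    define B where "B n = C * ((norm (\<xi> n))\<^sup>2 + (norm (\<eta> n))\<^sup>2)" for n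
    have C0: "0 \<le> C"
      using norm_ge_zero C by (rule order_trans)
    have bound: "norm (cinner (\<xi> n) (blinfun_apply (f i) (\<eta> n))) \<le> B n" for n i
    proof -
      have "norm (cinner (\<xi> n) (blinfun_apply (f i) (\<eta> n))) \<le> norm (\<xi> n) * (C * norm (\<eta> n))"
        by (rule order_trans[OF cinner_bound], rule mult_left_mono,
            rule order_trans[OF norm_blinfun]) (simp_all add: mult_right_mono C)
      also have "\<dots> = C * (norm (\<xi> n) * norm (\<eta> n))"
        by simp
      also have "\<dots> \<le> B n"
        unfolding B_def
        using sum_squares_bound[of "norm (\<xi> n)" "norm (\<eta> n)"] mult_nonneg_nonneg[of "norm (\<xi> n)" "norm (\<eta> n)"]
        by (intro mult_left_mono C0) (simp del: mult_nonneg_nonneg)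
      finally show ?thesis .
    qed
    have "((\<lambda>i. \<Sum>n. cinner (\<xi> n) (blinfun_apply (f i) (\<eta> n))) \<longlongrightarrow>
        (\<Sum>n. cinner (\<xi> n) (blinfun_apply b (\<eta> n)))) F"
    proof (rule tannerys_theorem[THEN conjunct2, THEN conjunct2])
      show "summable B"
        unfolding B_def using sq by (intro summable_mult summable_add) (simp_all add: square_summable_def)
      show "((\<lambda>i. cinner (\<xi> k) (blinfun_apply (f i) (\<eta> k))) \<longlongrightarrow> cinner (\<xi> k) (blinfun_apply b (\<eta> k))) F" for k
        using f by (simp add: bounded_wot_limit_def)
    qed (simp_all add: bound False case_prod_unfold)
    moreover have "(\<Sum>n. cinner (\<xi> n) (blinfun_apply b (\<eta> n))) \<in> V"
      using Basis S by simp
    ultimately have "\<forall>\<^sub>F i in F. (\<Sum>n. cinner (\<xi> n) (blinfun_apply (f i) (\<eta> n))) \<in> V"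
      using V topological_tendstoD by blast
    then show ?case
      using f by (simp add: S bounded_wot_limit_def)
  next
    case (UN K)
    then obtain k where "k \<in> K" "b \<in> k"
      by blast
    with UN(2) have "\<forall>\<^sub>F i in F. f i \<in> k"
      by blast
    then show ?case
      by eventually_elim (use \<open>k \<in> K\<close> in blast)
  qed (auto simp: eventually_conj)
  then show ?thesis
    unfolding limitin_def using f
    by (auto simp: topspace_ultraweak_topology bounded_wot_limit_def)
      (auto simp: ultraweak_topology_def openin_topology_generated_by_iff)
qed (use f in \<open>simp add: limitin_def topspace_ultraweak_topology bounded_wot_limit_def\<close>)

text \<open>Sequences supported at index 0 turn a single matrix element into one of the functionals
  that generate the topology.\<close>

lemma limitin_ultraweak_imp_tendsto:
  assumes f: "limitin ultraweak_topology f b F" and fb: "\<And>i. f i \<in> bounded_ops"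
  shows "((\<lambda>i. cinner x (blinfun_apply (f i) y)) \<longlongrightarrow> cinner x (blinfun_apply b y)) F"
proof (rule topological_tendstoI)
  fix V assume V: "open V" "cinner x (blinfun_apply b y) \<in> V"
  define \<xi> where "\<xi> n = (if n = 0 then x else 0)" for n :: nat
  define \<eta> where "\<eta> n = (if n = 0 then y else 0)" for n :: nat
  have sq: "square_summable \<xi>" "square_summable \<eta>"
    unfolding square_summable_def \<xi>_def \<eta>_def
    by (rule summable_finite[of "{0}"]; simp)+
  have sum: "(\<Sum>n. cinner (\<xi> n) (blinfun_apply a (\<eta> n))) = cinner x (blinfun_apply a y)" for a
    by (subst suminf_finite[of "{0}"]) (auto simp: \<xi>_def \<eta>_def)
  let ?W = "{a \<in> bounded_ops. (\<Sum>n. cinner (\<xi> n) (blinfun_apply a (\<eta> n))) \<in> V}"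
  have "openin ultraweak_topology ?W"
    unfolding ultraweak_topology_def
    by (rule topology_generated_by_Basis) (use sq V in blast)
  moreover have "b \<in> ?W"
    using f V by (simp add: sum limitin_def topspace_ultraweak_topology)
  ultimately have "\<forall>\<^sub>F i in F. f i \<in> ?W"
    using f unfolding limitin_def by blast
  then show "\<forall>\<^sub>F i in F. cinner x (blinfun_apply (f i) y) \<in> V"
    by (simp add: sum fb)
qed

text \<open>By Tychonoff's theorem the matrix elements \<open>\<langle>x, f i y\<rangle>\<close> converge simultaneously along some
  finer filter.\<close>

lemma bounded_wot_cluster_point:
  fixes f :: "'i \<Rightarrow> 'h::chilbert_space \<Rightarrow>\<^sub>L 'h"
  assumes f: "\<And>i. f i \<in> bounded_ops" and C: "\<And>i. norm (f i) \<le> C" and F: "F \<noteq> bot"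
  shows "\<exists>G b. G \<le> F \<and> G \<noteq> bot \<and> bounded_wot_limit f b G"
proof -
  define m where "m i = (\<lambda>(x, y). cinner x (blinfun_apply (f i) y))" for i
  \<comment> \<open>A point of this product is a table of candidate matrix elements, and every
    \<open>m i\<close> lies in it.\<close>
  define K where "K = (\<Pi>\<^sub>E (x, y)\<in>(UNIV :: ('h \<times> 'h) set). cball (0::complex) (C * norm x * norm y))"
  have "compact K"
    unfolding K_def compactin_euclidean_iff[symmetric] euclidean_product_topology[symmetric]
      compactin_PiE
    by auto
  moreover have mK: "m i \<in> K" for i
  proof -
    have "cmod (cinner x (blinfun_apply (f i) y)) \<le> C * norm x * norm y" for x y
    proof -
      have "cmod (cinner x (blinfun_apply (f i) y)) \<le> norm x * (C * norm y)"
        by (rule order_trans[OF cinner_bound], rule mult_left_mono,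
            rule order_trans[OF norm_blinfun]) (simp_all add: mult_right_mono C)
      then show ?thesis
        by (simp add: mult_ac)
    qed
    then show ?thesis
      by (auto simp: K_def m_def)
  qed
  moreover have "filtermap m F \<noteq> bot"
    using F by (simp add: filtermap_bot_iff)
  ultimately obtain g where g: "g \<in> K" "inf (nhds g) (filtermap m F) \<noteq> bot"
    unfolding compact_filter by (force simp: eventually_filtermap)
  \<comment> \<open>\<open>F\<close> is refined by the preimages of the neighbourhoods of the
    cluster point \<open>g\<close>, so that \<open>m\<close> converges to \<open>g\<close> along
    \<open>G\<close>.\<close>
  define G where "G = inf F (filtercomap m (nhds g))"
  have G: "G \<noteq> bot"
  proof
    assume "G = bot"
    then have "eventually (\<lambda>_. False) G"
      by simp
    then obtain P Q where P: "eventually P F" and Q: "eventually Q (filtercomap m (nhds g))"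
      and PQ: "\<And>i. P i \<Longrightarrow> Q i \<Longrightarrow> False"
      unfolding G_def eventually_inf by blast
    obtain R where R: "eventually R (nhds g)" "\<And>i. R (m i) \<Longrightarrow> Q i"
      using Q unfolding eventually_filtercomap by blast
    have "eventually (\<lambda>h. \<not> R h) (filtermap m F)"
      unfolding eventually_filtermap using P by eventually_elim (use PQ R in blast)
    then have "eventually (\<lambda>_. False) (inf (nhds g) (filtermap m F))"
      unfolding eventually_inf using R by blast
    then show False
      using g by (simp add: trivial_limit_def)
  qed
  have "filterlim m (nhds g) G"
    unfolding filterlim_iff_le_filtercomap G_def by simp
  then have lim: "((\<lambda>i. cinner x (blinfun_apply (f i) y)) \<longlongrightarrow> g (x, y)) G" for x y
  proof -
    have "((\<lambda>i. m i (x, y)) \<longlongrightarrow> g (x, y)) G"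
      by (rule continuous_on_tendsto_compose[OF continuous_on_product_coordinates
            \<open>filterlim m (nhds g) G\<close>]) simp_all
    then show ?thesis
      by (simp add: m_def)
  qed
  note uniq = tendsto_unique[OF G]
  \<comment> \<open>Sesquilinearity and the bound survive the pointwise limit, so the limit table is
    again that of an operator.\<close>
  have "\<exists>b\<in>bounded_ops. \<forall>x y. g (x, y) = cinner x (blinfun_apply b y)"
  proof (rule bounded_sesquilinear_form_representation[where g = "\<lambda>x y. g (x, y)" and C = C])
    show "g (x + x', y) = g (x, y) + g (x', y)" for x x' y
      using lim[of "x + x'" y] tendsto_add[OF lim[of x y] lim[of x' y]]
      by (intro uniq) (simp_all add: cinner_add_left)
    show "g (x, y + y') = g (x, y) + g (x, y')" for x y y'
      using lim[of x "y + y'"] tendsto_add[OF lim[of x y] lim[of x y']]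
      by (intro uniq) (simp_all add: cinner_add_right blinfun.add_right)
    show "g (c *\<^sub>C x, y) = cnj c * g (x, y)" for c x y
      using lim[of "c *\<^sub>C x" y] tendsto_mult_left[OF lim[of x y], of "cnj c"]
      by (intro uniq) (simp_all add: cinner_scaleC_left)
    show "g (x, c *\<^sub>C y) = c * g (x, y)" for c x y
      using lim[of x "c *\<^sub>C y"] tendsto_mult_left[OF lim[of x y], of c]
      by (intro uniq) (simp_all add: cinner_scaleC_right bounded_ops_scaleC f)
    show "cmod (g (x, y)) \<le> C * norm x * norm y" for x y
      using g(1) by (auto simp: K_def PiE_def Pi_def)
  qed
  then obtain b where b: "b \<in> bounded_ops" "\<And>x y. g (x, y) = cinner x (blinfun_apply b y)"
    by blast
  have "bounded_wot_limit f b G"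
    using f b C lim by (auto simp: bounded_wot_limit_def)
  moreover have "G \<le> F"
    by (simp add: G_def)
  ultimately show ?thesis
    using G by blast
qed


section \<open>Bilinearity of operator composition\<close>

lemma blinfun_compose_add_left: "(a + b) o\<^sub>L c = (a o\<^sub>L c) + (b o\<^sub>L c)"
  by (rule blinfun_eqI) (simp add: blinfun.add_left)

lemma blinfun_compose_add_right: "a o\<^sub>L (b + c) = (a o\<^sub>L b) + (a o\<^sub>L c)"
  by (rule blinfun_eqI) (simp add: blinfun.add_left blinfun.add_right)

lemma blinfun_compose_diff_left: "(a - b) o\<^sub>L c = (a o\<^sub>L c) - (b o\<^sub>L c)"
  by (rule blinfun_eqI) (simp add: blinfun.diff_left)

lemma blinfun_compose_diff_right: "a o\<^sub>L (b - c) = (a o\<^sub>L b) - (a o\<^sub>L c)"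
  by (rule blinfun_eqI) (simp add: blinfun.diff_left blinfun.diff_right)


lemma blinfun_compose_scaleC_right: "a \<in> bounded_ops \<Longrightarrow> a o\<^sub>L (z *\<^sub>C b) = z *\<^sub>C (a o\<^sub>L b)"
  by (rule blinfun_eqI) (simp add: bounded_ops_scaleC)



lemma blinfun_compose_id_left [simp]: "id_blinfun o\<^sub>L a = a"
  by (rule blinfun_eqI) simp

lemma blinfun_compose_id_right [simp]: "a o\<^sub>L id_blinfun = a"
  by (rule blinfun_eqI) simp

lemma double_eq_imp_eq: "a + a = b + b \<Longrightarrow> a = b" for a b :: "'v::real_vector"
  using scaleR_cancel_left[of 2 a b] by (simp add: scaleR_2)

subsection \<open>Von Neumann algebras and faithful normal states\<close>

locale vn_algebra =
  fixes M :: "('h::chilbert_space \<Rightarrow>\<^sub>L 'h) set"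
  assumes vn: "von_neumann_algebra M"
begin

lemma ops [intro]: "a \<in> M \<Longrightarrow> a \<in> bounded_ops"
  using vn by (auto simp: von_neumann_algebra_def)

lemma commutantD:
  assumes "a \<in> M" "c \<in> commutant M"
  shows "blinfun_apply c (blinfun_apply a x) = blinfun_apply a (blinfun_apply c x)"
proof -
  have "a o\<^sub>L c = c o\<^sub>L a"
    using assms by (auto simp: commutant_def)
  then show ?thesis
    by (metis blinfun_apply_blinfun_compose)
qed

text \<open>\<open>M\<close> equals its bicommutant, so commuting with \<open>commutant M\<close> is
  enough. Closure under linear operations, products and weak limits rests on this criterion.\<close>

lemma memI:
  assumes "a \<in> bounded_ops"
    and "\<And>c x. c \<in> commutant M \<Longrightarrow>
      blinfun_apply c (blinfun_apply a x) = blinfun_apply a (blinfun_apply c x)"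
  shows "a \<in> M"
proof -
  have "a \<in> commutant (commutant M)"
    using assms unfolding commutant_def[of "commutant M"] by (auto intro!: blinfun_eqI)
  then show ?thesis
    using vn by (simp add: von_neumann_algebra_def)
qed

lemma adj_closed: "a \<in> M \<Longrightarrow> adj a \<in> M"
  using vn by (simp add: von_neumann_algebra_def)

lemma add_closed:
  assumes "a \<in> M" "b \<in> M"
  shows "a + b \<in> M"
proof (rule memI)
  fix c x assume "c \<in> commutant M"
  with assms show "blinfun_apply c (blinfun_apply (a + b) x) = blinfun_apply (a + b) (blinfun_apply c x)"
    by (simp add: commutantD blinfun.add_left blinfun.add_right)
qed (intro bounded_ops_add ops assms)

lemma smult_closed: "a \<in> M \<Longrightarrow> z *\<^sub>C a \<in> M"
proof (rule memI)
  fix c x assume "a \<in> M" and c: "c \<in> commutant M"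
  then show "blinfun_apply c (blinfun_apply (z *\<^sub>C a) x) = blinfun_apply (z *\<^sub>C a) (blinfun_apply c x)"
    by (simp add: commutantD bounded_ops_scaleC[of c] commutant_def)
qed (intro bounded_ops_smult ops)

lemma diff_closed: "a \<in> M \<Longrightarrow> b \<in> M \<Longrightarrow> a - b \<in> M"
  using add_closed[of a "(- 1) *\<^sub>C b"] smult_closed[of b "- 1"]
  by (simp add: scaleC_blinfun_minus1)

lemma compose_closed:
  assumes "a \<in> M" "b \<in> M"
  shows "a o\<^sub>L b \<in> M"
proof (rule memI)
  fix c x assume "c \<in> commutant M"
  with assms show "blinfun_apply c (blinfun_apply (a o\<^sub>L b) x) = blinfun_apply (a o\<^sub>L b) (blinfun_apply c x)"
    by (simp add: commutantD)
qed (intro bounded_ops_compose ops assms)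

lemma id_closed: "id_blinfun \<in> M"
  by (rule memI[OF bounded_ops_id]) simp

lemmas closed = adj_closed add_closed smult_closed diff_closed compose_closed id_closed

text \<open>Commutation with \<open>c\<close> can be tested on matrix elements; moving
  \<open>c\<close> to the left as \<open>adj c\<close> lets both sides pass to the limit.\<close>

lemma bounded_wot_limit_closed:
  assumes "bounded_wot_limit f b F" and F: "F \<noteq> bot" and f: "\<And>i. f i \<in> M"
  shows "b \<in> M"
proof (rule memI)
  have lim: "((\<lambda>i. cinner x (blinfun_apply (f i) y)) \<longlongrightarrow> cinner x (blinfun_apply b y)) F" for x y
    using assms(1) by (simp add: bounded_wot_limit_def)
  show "b \<in> bounded_ops"
    using assms(1) by (simp add: bounded_wot_limit_def)
  fix c y assume c: "c \<in> commutant M"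
  then have c': "c \<in> bounded_ops"
    by (simp add: commutant_def)
  show "blinfun_apply c (blinfun_apply b y) = blinfun_apply b (blinfun_apply c y)"
  proof (rule cinner_right_eqI)
    fix x
    have "cinner (blinfun_apply (adj c) x) (blinfun_apply (f i) y)
        = cinner x (blinfun_apply (f i) (blinfun_apply c y))" for i
      by (simp add: cinner_adj' c' commutantD[OF f c])
    then have "cinner (blinfun_apply (adj c) x) (blinfun_apply b y)
        = cinner x (blinfun_apply b (blinfun_apply c y))"
      using lim[of "blinfun_apply (adj c) x" y] lim[of x "blinfun_apply c y"]
        tendsto_unique[OF F] by simp
    then show "cinner x (blinfun_apply c (blinfun_apply b y))
        = cinner x (blinfun_apply b (blinfun_apply c y))"
      by (simp add: cinner_adj' c')
  qed
qed

text \<open>Bounded weak operator convergence is ultraweak convergence, along which functionals in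
  the predual are continuous.\<close>

lemma predual_tendsto:
  assumes \<omega>: "\<omega> \<in> predual M" and f: "bounded_wot_limit f b F"
    and M: "\<And>i. f i \<in> M" "b \<in> M"
  shows "((\<lambda>i. \<omega> (f i)) \<longlongrightarrow> \<omega> b) F"
proof -
  have "limitin (subtopology ultraweak_topology M) f b F"
    using bounded_wot_limit_imp_limitin_ultraweak[OF f] M by (simp add: limitin_subtopology)
  moreover have "continuous_map (subtopology ultraweak_topology M) euclidean \<omega>"
    using \<omega> by (simp add: predual_def)
  ultimately have "limitin euclidean (\<omega> \<circ> f) (\<omega> b) F"
    by (intro continuous_map_limit)
  then show ?thesis
    by (simp add: comp_def)
qed

end

locale vn_state = vn_algebra M for M :: "('h::chilbert_space \<Rightarrow>\<^sub>L 'h) set" +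
  fixes \<phi> :: "('h \<Rightarrow>\<^sub>L 'h) \<Rightarrow> complex"
  assumes state: "normal_faithful_state M \<phi>"
begin

text \<open>The squared norm of the GNS vector of \<open>a\<close>.\<close>

definition gns_sq :: "('h \<Rightarrow>\<^sub>L 'h) \<Rightarrow> real" where
  "gns_sq a = Re (\<phi> (adj a o\<^sub>L a))"

lemma predual: "\<phi> \<in> predual M"
  using state by (simp add: normal_faithful_state_def)

lemma state_add: "a \<in> M \<Longrightarrow> b \<in> M \<Longrightarrow> \<phi> (a + b) = \<phi> a + \<phi> b"
  using predual by (simp add: predual_def)

lemma state_smult: "a \<in> M \<Longrightarrow> \<phi> (c *\<^sub>C a) = c * \<phi> a"
  using predual by (simp add: predual_def)

lemma state_diff: "a \<in> M \<Longrightarrow> b \<in> M \<Longrightarrow> \<phi> (a - b) = \<phi> a - \<phi> b"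
  using state_add[of a "(- 1) *\<^sub>C b"] state_smult[of b "- 1"] smult_closed[of b "- 1"]
  by (simp add: scaleC_blinfun_minus1)

lemma state_zero: "\<phi> 0 = 0"
  using state_diff[OF id_closed id_closed] by simp

lemma state_id: "\<phi> id_blinfun = 1"
  using state by (simp add: normal_faithful_state_def)

lemma state_positive:
  assumes "a \<in> M" "positive_op a"
  shows "\<phi> a \<in> \<real>" "0 \<le> Re (\<phi> a)" "\<phi> a = 0 \<Longrightarrow> a = 0"
  using state assms by (auto simp: normal_faithful_state_def)

lemma state_square:
  assumes "a \<in> M"
  shows "\<phi> (adj a o\<^sub>L a) = of_real (gns_sq a)" "0 \<le> gns_sq a"
  using state_positive[OF _ positive_op_adj_compose, of a] assms
  by (auto simp: gns_sq_def closed ops)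

text \<open>Faithfulness yields \<open>a\<^sup>* a = 0\<close>, and the quadratic form of
  \<open>a\<^sup>* a\<close> at \<open>x\<close> is
  \<open>\<parallel>a x\<parallel>\<^sup>2\<close>.\<close>

lemma gns_sq_eq_0:
  assumes a: "a \<in> M" and "gns_sq a = 0"
  shows "a = 0"
proof -
  have "adj a o\<^sub>L a = 0"
    using state_positive(3)[OF _ positive_op_adj_compose, of a] state_square(1)[OF a] assms
    by (auto simp: closed ops)
  then have "complex_of_real ((norm (blinfun_apply a x))\<^sup>2) = 0" for x
    using cinner_adj_compose_self[OF ops[OF a], of x] by (metis blinfun.zero_left cinner_zero_right)
  then show ?thesis
    by (intro blinfun_eqI) simp
qed

text \<open>Since \<open>a \<le> \<parallel>a\<parallel> 1\<close>, the element \<open>a\<close> is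
  a real multiple of the unit minus a positive one, and the state is real on both.\<close>

lemma state_self_adjoint_real:
  assumes a: "a \<in> M" "adj a = a"
  shows "\<phi> a \<in> \<real>"
proof -
  define p where "p = complex_of_real (norm a) *\<^sub>C id_blinfun - a"
  have p: "p \<in> M"
    by (simp add: p_def closed a)
  have "cinner x (blinfun_apply p x) \<in> \<real> \<and> 0 \<le> Re (cinner x (blinfun_apply p x))" for x
  proof -
    have "cinner x (blinfun_apply a x) = cnj (cinner x (blinfun_apply a x))"
      by (metis a ops cinner_adj cinner_commute)
    then have "cinner x (blinfun_apply a x) \<in> \<real>"
      by (metis Reals_cnj_iff)
    moreover have "Re (cinner x (blinfun_apply a x)) \<le> norm a * (norm x)\<^sup>2"
    proof -
      have "Re (cinner x (blinfun_apply a x)) \<le> norm x * norm (blinfun_apply a x)"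
        using complex_Re_le_cmod cinner_bound by (rule order_trans)
      also have "\<dots> \<le> norm x * (norm a * norm x)"
        by (intro mult_left_mono norm_blinfun norm_ge_zero)
      finally show ?thesis
        by (simp add: power2_eq_square mult_ac)
    qed
    ultimately show ?thesis
      by (simp add: p_def blinfun.diff_left cinner_diff_right cinner_scaleC_right cinner_self)
  qed
  then have "positive_op p"
    using p by (auto simp: positive_op_def)
  then have "\<phi> p \<in> \<real>"
    using p state_positive by blast
  moreover have "\<phi> a = of_real (norm a) - \<phi> p"
    by (simp add: p_def state_diff state_smult state_id closed a)
  ultimately show ?thesis
    by simp
qed

lemma state_adj:
  assumes a: "a \<in> M"
  shows "\<phi> (adj a) = cnj (\<phi> a)"
proof -
  have a': "a \<in> bounded_ops" "adj a \<in> bounded_ops"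
    using a by (auto simp: closed)
  have "\<phi> (a + adj a) \<in> \<real>"
    by (rule state_self_adjoint_real) (simp_all add: a a' closed adj_add adj_adj add.commute)
  moreover have "\<phi> (\<i> *\<^sub>C a + (- \<i>) *\<^sub>C adj a) \<in> \<real>"
    by (rule state_self_adjoint_real)
      (simp_all add: a a' closed adj_add adj_smult adj_adj bounded_ops_smult add.commute)
  ultimately have "Im (\<phi> a + \<phi> (adj a)) = 0" "Im (\<i> * \<phi> a - \<i> * \<phi> (adj a)) = 0"
    using a by (auto simp: state_add state_smult closed complex_is_Real_iff)
  then show ?thesis
    by (simp add: complex_eq_iff)
qed

lemma state_adj_compose_commute:
  "a \<in> M \<Longrightarrow> b \<in> M \<Longrightarrow> \<phi> (adj b o\<^sub>L a) = cnj (\<phi> (adj a o\<^sub>L b))"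
  using state_adj[of "adj a o\<^sub>L b"] by (simp add: closed ops adj_compose adj_adj)

lemma gns_sq_diff:
  assumes "a \<in> M" "b \<in> M"
  shows "gns_sq (a - b) = gns_sq a - 2 * Re (\<phi> (adj a o\<^sub>L b)) + gns_sq b"
  using assms
  by (simp add: gns_sq_def adj_diff ops blinfun_compose_diff_left blinfun_compose_diff_right
      state_diff closed state_adj_compose_commute[of a b])

text \<open>The inequality is nonnegativity of \<open>gns_sq (a - z *\<^sub>C b)\<close> at the
  minimizing scalar \<open>z\<close>. If \<open>gns_sq b = 0\<close>, faithfulness gives
  \<open>b = 0\<close>.\<close>

lemma gns_cauchy_schwarz:
  assumes a: "a \<in> M" and b: "b \<in> M"
  shows "(cmod (\<phi> (adj a o\<^sub>L b)))\<^sup>2 \<le> gns_sq a * gns_sq b"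
proof (cases "gns_sq b = 0")
  case True
  then have "b = 0"
    using gns_sq_eq_0 b by blast
  then have "adj a o\<^sub>L b = 0"
    by (intro blinfun_eqI) simp
  then have "\<phi> (adj a o\<^sub>L b) = 0"
    by (simp add: state_zero)
  then show ?thesis
    by (simp add: state_square a b)
next
  case False
  then have q: "gns_sq b > 0"
    using state_square(2)[OF b] by simp
  define r where "r = \<phi> (adj a o\<^sub>L b)"
  define z where "z = cnj r / gns_sq b"
  have zb: "z *\<^sub>C b \<in> M"
    by (simp add: closed b)
  have "adj (z *\<^sub>C b) o\<^sub>L (z *\<^sub>C b) = (cnj z * z) *\<^sub>C (adj b o\<^sub>L b)"
    by (rule blinfun_eqI) (simp add: adj_smult ops b bounded_ops_scaleC adj_in_bounded_ops scaleC_scaleC)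
  then have 1: "gns_sq (z *\<^sub>C b) = (cmod z)\<^sup>2 * gns_sq b"
    unfolding gns_sq_def
    by (simp add: state_smult closed b state_square mult.commute[of "cnj z"] complex_norm_square[symmetric]
        del: of_real_power)
  have 2: "\<phi> (adj a o\<^sub>L (z *\<^sub>C b)) = z * r"
    by (simp add: r_def blinfun_compose_scaleC_right adj_in_bounded_ops ops a b state_smult closed)
  have "z * r = of_real ((cmod r)\<^sup>2 / gns_sq b)"
    by (simp add: z_def complex_norm_square mult.commute del: of_real_power)
  moreover have "(cmod z)\<^sup>2 * gns_sq b = (cmod r)\<^sup>2 / gns_sq b"
    using q by (simp add: z_def norm_divide power_divide power2_eq_square)
  ultimately have "gns_sq (a - z *\<^sub>C b) = gns_sq a - (cmod r)\<^sup>2 / gns_sq b"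
    using gns_sq_diff[OF a zb] by (simp add: 1 2)
  then have "(cmod r)\<^sup>2 / gns_sq b \<le> gns_sq a"
    using state_square(2)[of "a - z *\<^sub>C b"] by (simp add: closed a b)
  then show ?thesis
    using q by (simp add: r_def divide_le_eq)
qed

end


subsection \<open>Schwartz maps\<close>

locale schwartz_map = vn_algebra M for M :: "('h::chilbert_space \<Rightarrow>\<^sub>L 'h) set" +
  fixes \<Phi> :: "('h \<Rightarrow>\<^sub>L 'h) \<Rightarrow> ('h \<Rightarrow>\<^sub>L 'h)"
  assumes schwartz: "unital_schwartz_map M \<Phi>"
begin

lemma map_closed: "a \<in> M \<Longrightarrow> \<Phi> a \<in> M"
  using schwartz by (simp add: unital_schwartz_map_def)

lemma map_add: "a \<in> M \<Longrightarrow> b \<in> M \<Longrightarrow> \<Phi> (a + b) = \<Phi> a + \<Phi> b"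
  using schwartz by (simp add: unital_schwartz_map_def)

lemma map_smult: "a \<in> M \<Longrightarrow> \<Phi> (c *\<^sub>C a) = c *\<^sub>C \<Phi> a"
  using schwartz by (simp add: unital_schwartz_map_def)

lemma map_diff: "a \<in> M \<Longrightarrow> b \<in> M \<Longrightarrow> \<Phi> (a - b) = \<Phi> a - \<Phi> b"
  using map_add[of a "(- 1) *\<^sub>C b"] map_smult[of b "- 1"] smult_closed[of b "- 1"]
  by (simp add: scaleC_blinfun_minus1)

lemma map_zero: "\<Phi> 0 = 0"
  using map_diff[OF id_closed id_closed] by simp

lemma map_id: "\<Phi> id_blinfun = id_blinfun"
  using schwartz by (simp add: unital_schwartz_map_def)

lemma map_schwarz:
  assumes "a \<in> M"
  shows "positive_op (\<Phi> (adj a) o\<^sub>L \<Phi> a)"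
    and "positive_op (\<Phi> (adj a o\<^sub>L a) - (\<Phi> (adj a) o\<^sub>L \<Phi> a))"
  using schwartz assms by (auto simp: unital_schwartz_map_def op_le_def)

text \<open>Both \<open>\<Phi> h \<Phi> h\<close> and \<open>(\<Phi> h + 1) (\<Phi> h + 1)\<close> are positive, hence self-adjoint, and so is
  their difference \<open>2 \<Phi> h + 1\<close>.\<close>

lemma map_self_adjoint:
  assumes h: "h \<in> M" "adj h = h"
  shows "adj (\<Phi> h) = \<Phi> h"
proof -
  define p where "p = \<Phi> h o\<^sub>L \<Phi> h"
  have p: "p \<in> M" "adj p = p"
    using positive_op_self_adjoint[OF map_schwarz(1)[OF h(1)]] h
    by (simp_all add: p_def map_closed closed)
  have "adj (h + id_blinfun) = h + id_blinfun"
    using h by (simp add: adj_add ops bounded_ops_id adj_id)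
  then have "positive_op ((\<Phi> h + id_blinfun) o\<^sub>L (\<Phi> h + id_blinfun))"
    using map_schwarz(1)[of "h + id_blinfun"] h by (simp add: map_add map_id closed)
  moreover have "(\<Phi> h + id_blinfun) o\<^sub>L (\<Phi> h + id_blinfun) = p + (\<Phi> h + \<Phi> h) + id_blinfun"
    by (simp add: p_def blinfun_compose_add_left blinfun_compose_add_right)
  ultimately have "adj (p + (\<Phi> h + \<Phi> h) + id_blinfun) = p + (\<Phi> h + \<Phi> h) + id_blinfun"
    using positive_op_self_adjoint by fastforce
  then have "adj (\<Phi> h) + adj (\<Phi> h) = \<Phi> h + \<Phi> h"
    using p h by (simp add: adj_add ops closed map_closed adj_id)
  then show ?thesis
    by (rule double_eq_imp_eq)
qed

lemma map_adj:
  assumes a: "a \<in> M"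
  shows "\<Phi> (adj a) = adj (\<Phi> a)"
proof -
  have a': "a \<in> bounded_ops" "adj a \<in> bounded_ops" "\<Phi> a \<in> bounded_ops" "\<Phi> (adj a) \<in> bounded_ops"
    using a by (auto simp: closed map_closed)
  have 1: "adj (\<Phi> (a + adj a)) = \<Phi> (a + adj a)"
    by (rule map_self_adjoint) (simp_all add: a a' closed adj_add adj_adj add.commute)
  have "(- \<i>) *\<^sub>C (adj a - a) = \<i> *\<^sub>C (a - adj a)"
  proof (rule blinfun_eqI)
    fix x
    have "(- \<i>) *\<^sub>C y = \<i> *\<^sub>C (- y)" for y :: 'h
      using scaleC_scaleC[of \<i> "- 1" y] scaleC_of_real[of "- 1" y] by simp
    from this[of "blinfun_apply (adj a - a) x"]
    show "blinfun_apply ((- \<i>) *\<^sub>C (adj a - a)) x = blinfun_apply (\<i> *\<^sub>C (a - adj a)) x"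
      by (simp add: blinfun.diff_left)
  qed
  then have "adj (\<Phi> (\<i> *\<^sub>C (a - adj a))) = \<Phi> (\<i> *\<^sub>C (a - adj a))"
    by (intro map_self_adjoint) (simp_all add: a a' closed adj_diff adj_smult adj_adj bounded_ops_diff)
  then have "(- \<i>) *\<^sub>C (adj (\<Phi> a) - adj (\<Phi> (adj a))) = \<i> *\<^sub>C (\<Phi> a - \<Phi> (adj a))"
    using a a' by (simp add: map_smult map_diff closed adj_smult adj_diff bounded_ops_diff)
  then have "\<i> *\<^sub>C ((- \<i>) *\<^sub>C (adj (\<Phi> a) - adj (\<Phi> (adj a)))) = \<i> *\<^sub>C (\<i> *\<^sub>C (\<Phi> a - \<Phi> (adj a)))"
    by simp
  moreover have "c *\<^sub>C (d *\<^sub>C x) = (c * d) *\<^sub>C x" for c d and x :: "'h \<Rightarrow>\<^sub>L 'h"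
    by (rule blinfun_eqI) (simp add: scaleC_scaleC)
  moreover have "1 *\<^sub>C x = x" for x :: "'h \<Rightarrow>\<^sub>L 'h"
    by (rule blinfun_eqI) (simp add: scaleC_one)
  ultimately have 2: "adj (\<Phi> a) - adj (\<Phi> (adj a)) = \<Phi> (adj a) - \<Phi> a"
    by (simp add: scaleC_blinfun_minus1)
  have "adj (\<Phi> a) + adj (\<Phi> (adj a)) = \<Phi> (adj a) + \<Phi> a"
    using 1 a a' by (simp add: map_add adj_add closed add.commute)
  with 2 have "(\<Phi> (adj a) - \<Phi> a) + (\<Phi> (adj a) + \<Phi> a)
      = (adj (\<Phi> a) - adj (\<Phi> (adj a))) + (adj (\<Phi> a) + adj (\<Phi> (adj a)))"
    by simp
  then have "\<Phi> (adj a) + \<Phi> (adj a) = adj (\<Phi> a) + adj (\<Phi> a)"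
    by (simp del: add_diff_cancel_right)
  then show ?thesis
    by (rule double_eq_imp_eq)
qed

text \<open>The conclusion is only ultraweak: no uniform bound on \<open>\<Phi> (f i)\<close> is at
  hand yet, and the contraction estimate below uses this lemma.\<close>

lemma map_limitin_ultraweak:
  assumes f: "bounded_wot_limit f b F" and M: "\<And>i. f i \<in> M" "b \<in> M"
  shows "limitin ultraweak_topology (\<lambda>i. \<Phi> (f i)) (\<Phi> b) F"
proof -
  have "limitin (subtopology ultraweak_topology M) f b F"
    using bounded_wot_limit_imp_limitin_ultraweak[OF f] M by (simp add: limitin_subtopology)
  moreover have "continuous_map (subtopology ultraweak_topology M) (subtopology ultraweak_topology M) \<Phi>"
    using schwartz by (simp add: unital_schwartz_map_def)
  ultimately have "limitin (subtopology ultraweak_topology M) (\<Phi> \<circ> f) (\<Phi> b) F"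
    by (intro continuous_map_limit)
  then show ?thesis
    by (simp add: comp_def limitin_subtopology)
qed

lemma norm_map_square_le:
  assumes "a \<in> M"
  shows "(norm (blinfun_apply (\<Phi> a) x))\<^sup>2 \<le> Re (cinner x (blinfun_apply (\<Phi> (adj a o\<^sub>L a)) x))"
proof -
  have "0 \<le> Re (cinner x (blinfun_apply (\<Phi> (adj a o\<^sub>L a) - (adj (\<Phi> a) o\<^sub>L \<Phi> a)) x))"
    using map_schwarz(2)[OF assms] by (simp add: positive_op_def map_adj assms)
  then show ?thesis
    using assms cinner_adj_compose_self[of "\<Phi> a" x]
    by (simp add: blinfun.diff_left cinner_diff_right ops map_closed)
qed

text \<open>The expectations \<open>s n = \<langle>x, \<Phi>(h\<^bsup>2^n\<^esup>) x\<rangle>\<close> satisfy \<open>(s n)\<^sup>2 \<le> \<parallel>x\<parallel>\<^sup>2 s (n + 1)\<close> and tend to \<open>0\<close>,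
  which is impossible if \<open>s 0 > \<parallel>x\<parallel>\<^sup>2\<close>.\<close>

lemma map_expectation_le:
  assumes h: "h \<in> M" "adj h = h" "norm h < 1"
  shows "Re (cinner x (blinfun_apply (\<Phi> h) x)) \<le> (norm x)\<^sup>2"
proof (rule ccontr)
  assume contr: "\<not> ?thesis"
  define H where "H n = ((\<lambda>k. k o\<^sub>L k) ^^ n) h" for n
  \<comment> \<open>The power of \<open>h\<close> is \<open>2^n\<close>, but the weaker exponent
    \<open>Suc n\<close> in the norm bound already gives decay.\<close>
  have H: "H n \<in> M \<and> adj (H n) = H n \<and> norm (H n) \<le> norm h ^ Suc n" for n
  proof (induction n)
    case (Suc n)
    have "norm (H n o\<^sub>L H n) \<le> norm (H n) * norm (H n)"
      by (rule norm_blinfun_compose)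
    also have "\<dots> \<le> norm h ^ Suc n * norm h ^ Suc n"
      using Suc by (intro mult_mono) auto
    also have "\<dots> \<le> norm h ^ Suc n * norm h"
      using h power_le_one[of "norm h" n] by (intro mult_left_mono) (simp_all add: mult_left_le)
    finally show ?case
      using Suc by (simp add: H_def closed adj_compose ops mult.commute)
  qed (simp add: H_def h)
  define s where "s n = Re (cinner x (blinfun_apply (\<Phi> (H n)) x))" for n
  have "x \<noteq> 0"
    using contr by auto
  then have R: "(norm x)\<^sup>2 > 0"
    by simp
  have step: "(s n)\<^sup>2 \<le> (norm x)\<^sup>2 * s (Suc n)" for n
  proof -
    have "\<bar>s n\<bar> \<le> norm x * norm (blinfun_apply (\<Phi> (H n)) x)"
      unfolding s_def using abs_Re_le_cmod cinner_bound by (rule order_trans)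
    then have "(s n)\<^sup>2 \<le> (norm x * norm (blinfun_apply (\<Phi> (H n)) x))\<^sup>2"
      by (metis abs_ge_zero power2_abs power_mono)
    also have "\<dots> \<le> (norm x)\<^sup>2 * s (Suc n)"
      using norm_map_square_le[of "H n" x] H[of n]
      by (simp add: power_mult_distrib s_def H_def mult_left_mono)
    finally show ?thesis .
  qed
  \<comment> \<open>If \<open>s n\<close> exceeds \<open>\<parallel>x\<parallel>\<^sup>2\<close>,
    then \<open>step\<close> gives \<open>\<parallel>x\<parallel>\<^sup>4 <
    \<parallel>x\<parallel>\<^sup>2 s (n + 1)\<close>, so the excess persists.\<close>
  have big: "s n > (norm x)\<^sup>2" for n
  proof (induction n)
    case 0
    then show ?case
      using contr by (simp add: s_def H_def)
  next
    case (Suc n)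
    have "0 < s n"
      using R Suc by linarith
    with Suc have "(norm x)\<^sup>2 * (norm x)\<^sup>2 < (s n)\<^sup>2"
      by (simp only: power2_eq_square[of "s n"]) (intro mult_strict_mono; simp)
    also note step[of n]
    finally show ?case
      using R by (simp only: mult_less_cancel_left_pos)
  qed
  \<comment> \<open>The strict bound \<open>norm h < 1\<close> drives \<open>H\<close> to 0 in norm;
    ultraweak continuity then carries this over to \<open>\<Phi> (H n)\<close>.\<close>
  have "(\<lambda>n. norm h ^ Suc n) \<longlonglongrightarrow> 0"
    using h by (intro LIMSEQ_Suc LIMSEQ_realpow_zero) auto
  then have Hlim: "H \<longlonglongrightarrow> 0"
    by (rule Lim_null_comparison[rotated]) (use H in \<open>auto intro!: always_eventually\<close>)
  have "bounded_wot_limit H 0 sequentially"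
    unfolding bounded_wot_limit_def
  proof (intro conjI allI exI)
    show "H n \<in> bounded_ops" for n
      using H by auto
    show "0 \<in> bounded_ops"
      by (simp add: bounded_ops_def)
        (metis cinner_right_eqI cinner_scaleC_right cinner_zero_right mult_zero_right)
    show "norm (H n) \<le> 1" for n
      using H[of n] power_le_one[of "norm h" "Suc n"] h(3) by (meson less_imp_le norm_ge_zero order_trans)
    show "(\<lambda>n. cinner u (blinfun_apply (H n) v)) \<longlonglongrightarrow> cinner u (blinfun_apply 0 v)" for u v
    proof (rule Lim_null_comparison[of _ "\<lambda>n. norm u * (norm (H n) * norm v)", THEN tendsto_eq_rhs])
      show "\<forall>\<^sub>F n in sequentially. norm (cinner u (blinfun_apply (H n) v)) \<le> norm u * (norm (H n) * norm v)"
        by (intro always_eventually allI order_trans[OF cinner_bound] mult_left_mono norm_blinfun) simp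
      show "(\<lambda>n. norm u * (norm (H n) * norm v)) \<longlonglongrightarrow> 0"
        using tendsto_norm[OF Hlim] by (intro tendsto_mult_right_zero tendsto_mult_left_zero) simp
    qed simp
  qed
  then have "limitin ultraweak_topology (\<lambda>n. \<Phi> (H n)) (\<Phi> 0) sequentially"
    by (rule map_limitin_ultraweak) (use H diff_closed[OF id_closed id_closed] in auto)
  then have "(\<lambda>n. cinner x (blinfun_apply (\<Phi> (H n)) x)) \<longlonglongrightarrow> cinner x (blinfun_apply (\<Phi> 0) x)"
    by (rule limitin_ultraweak_imp_tendsto) (use H map_closed in auto)
  then have "s \<longlonglongrightarrow> 0"
    unfolding s_def using tendsto_Re by (fastforce simp: map_zero)
  then have "(norm x)\<^sup>2 \<le> 0"
    by (rule LIMSEQ_le_const) (use big in \<open>auto intro: less_imp_le\<close>)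
  then show False
    using R by simp
qed

text \<open>Scaling by \<open>1 / r\<close> with \<open>r > norm a\<close> gives
  \<open>b\<^sup>* b\<close> norm below 1. Its expectation bound and the Schwarz inequality yield
  \<open>norm (\<Phi> b) \<le> 1\<close>, and \<open>r\<close> may be taken arbitrarily close to
  \<open>norm a\<close>.\<close>

lemma norm_map_le:
  assumes a: "a \<in> M"
  shows "norm (\<Phi> a) \<le> norm a"
proof (rule dense_ge)
  fix r assume r: "norm a < r"
  then have r0: "0 < r"
    using norm_ge_zero[of a] by linarith
  define b where "b = complex_of_real (1 / r) *\<^sub>C a"
  have b: "b \<in> M"
    by (simp add: b_def closed a)
  have "norm b < 1"
    using r r0 by (simp add: b_def scaleC_blinfun_of_real del: of_real_divide)
  moreover have "norm (adj b o\<^sub>L b) \<le> norm b * norm b"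
    by (rule order_trans[OF norm_blinfun_compose]) (simp add: mult_right_mono norm_adj_le ops b)
  ultimately have "norm (adj b o\<^sub>L b) < 1"
    using mult_strict_mono[of "norm b" 1 "norm b" 1] by simp
  then have "(norm (blinfun_apply (\<Phi> b) x))\<^sup>2 \<le> (norm x)\<^sup>2" for x
    by (intro order_trans[OF norm_map_square_le map_expectation_le])
      (simp_all add: b closed adj_compose adj_adj ops)
  then have "norm (blinfun_apply (\<Phi> b) x) \<le> 1 * norm x" for x
    using power2_le_imp_le[OF _ norm_ge_zero] by simp
  then have "norm (\<Phi> b) \<le> 1"
    by (intro norm_blinfun_bound) auto
  moreover have "\<Phi> b = (1 / r) *\<^sub>R \<Phi> a"
    unfolding b_def map_smult[OF a] by (rule scaleC_blinfun_of_real)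
  ultimately show "norm (\<Phi> a) \<le> r"
    using r0 by (simp add: field_simps)
qed

text \<open>Contractivity supplies the uniform bound on the images, ultraweak continuity the
  convergence of the matrix elements.\<close>

lemma bounded_wot_limit_map:
  assumes f: "bounded_wot_limit f b F" and M: "\<And>i. f i \<in> M" "b \<in> M"
  shows "bounded_wot_limit (\<lambda>i. \<Phi> (f i)) (\<Phi> b) F"
proof -
  obtain C where "\<And>i. norm (f i) \<le> C"
    using f unfolding bounded_wot_limit_def by blast
  then have "norm (\<Phi> (f i)) \<le> C" for i
    using norm_map_le[OF M(1)] order_trans by blast
  moreover have "((\<lambda>i. cinner x (blinfun_apply (\<Phi> (f i)) y)) \<longlongrightarrow> cinner x (blinfun_apply (\<Phi> b) y)) F" for x y
    by (rule limitin_ultraweak_imp_tendsto[OF map_limitin_ultraweak[OF assms]])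
      (auto simp: M map_closed)
  ultimately show ?thesis
    using M map_closed by (auto simp: bounded_wot_limit_def)
qed

section \<open>Iterates of a Schwartz map\<close>

lemma pow_closed: "a \<in> M \<Longrightarrow> (\<Phi> ^^ n) a \<in> M"
  by (induction n) (simp_all add: map_closed)

lemma pow_diff: "a \<in> M \<Longrightarrow> b \<in> M \<Longrightarrow> (\<Phi> ^^ n) (a - b) = (\<Phi> ^^ n) a - (\<Phi> ^^ n) b"
  by (induction n) (simp_all add: map_diff pow_closed)

lemma pow_adj: "a \<in> M \<Longrightarrow> (\<Phi> ^^ n) (adj a) = adj ((\<Phi> ^^ n) a)"
  by (induction n) (simp_all add: map_adj pow_closed)

lemma norm_pow_le: "a \<in> M \<Longrightarrow> norm ((\<Phi> ^^ n) a) \<le> norm a"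
  by (induction n) (auto intro: order_trans[OF norm_map_le] simp: pow_closed)

lemma bounded_wot_limit_pow:
  assumes "bounded_wot_limit f b F" "\<And>i. f i \<in> M" "b \<in> M"
  shows "bounded_wot_limit (\<lambda>i. (\<Phi> ^^ n) (f i)) ((\<Phi> ^^ n) b) F"
  using assms by (induction n) (simp_all add: bounded_wot_limit_map pow_closed)

end


subsection \<open>Quantum dynamical systems\<close>

text \<open>Both maps enter on an equal footing, so that \<open>swap\<close> makes every result
  available with their roles exchanged.\<close>

locale dynamical_pair = vn_state M \<phi> + fwd: schwartz_map M \<Phi> + bwd: schwartz_map M \<Phi>s
  for M :: "('h::chilbert_space \<Rightarrow>\<^sub>L 'h) set" and \<phi> \<Phi> \<Phi>s +
  assumes adjoint: "a \<in> M \<Longrightarrow> b \<in> M \<Longrightarrow> \<phi> (b o\<^sub>L \<Phi> a) = \<phi> (\<Phi>s b o\<^sub>L a)"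
begin

text \<open>The adjoint relation is applied to \<open>adj b\<close> and \<open>adj a\<close>, and
  complex conjugates are taken.\<close>

lemma swap: "dynamical_pair M \<phi> \<Phi>s \<Phi>"
proof unfold_locales
  fix a b assume M: "a \<in> M" "b \<in> M"
  have "\<phi> (adj (\<Phi>s a) o\<^sub>L adj b) = \<phi> (adj a o\<^sub>L \<Phi> (adj b))"
    using adjoint[of "adj b" "adj a"] M by (simp add: closed bwd.map_adj)
  also have "\<dots> = \<phi> (adj a o\<^sub>L adj (\<Phi> b))"
    using M by (simp add: fwd.map_adj)
  finally have "\<phi> (adj (b o\<^sub>L \<Phi>s a)) = \<phi> (adj (\<Phi> b o\<^sub>L a))"
    using M by (simp add: adj_compose ops fwd.map_closed bwd.map_closed)
  then show "\<phi> (b o\<^sub>L \<Phi>s a) = \<phi> (\<Phi> b o\<^sub>L a)"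
    using M by (simp add: state_adj closed fwd.map_closed bwd.map_closed)
qed

lemma invariant: "a \<in> M \<Longrightarrow> \<phi> (\<Phi> a) = \<phi> a"
  using adjoint[of a id_blinfun] by (simp add: closed bwd.map_id)

lemma pow_invariant: "a \<in> M \<Longrightarrow> \<phi> ((\<Phi> ^^ n) a) = \<phi> a"
  by (induction n) (simp_all add: invariant fwd.pow_closed)

lemma pow_adjoint:
  "a \<in> M \<Longrightarrow> b \<in> M \<Longrightarrow> \<phi> (b o\<^sub>L (\<Phi> ^^ n) a) = \<phi> ((\<Phi>s ^^ n) b o\<^sub>L a)"
proof (induction n arbitrary: b)
  case (Suc n)
  have "\<phi> (b o\<^sub>L \<Phi> ((\<Phi> ^^ n) a)) = \<phi> (\<Phi>s b o\<^sub>L (\<Phi> ^^ n) a)"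
    using Suc.prems by (simp add: adjoint fwd.pow_closed)
  also have "\<dots> = \<phi> ((\<Phi>s ^^ n) (\<Phi>s b) o\<^sub>L a)"
    using Suc by (simp add: bwd.map_closed)
  finally show ?case
    by (simp add: funpow_swap1)
qed simp

text \<open>The Schwarz defect \<open>d\<close> is positive and, by invariance, has expectation
  \<open>gns_sq a - gns_sq (\<Phi> a)\<close>. Positivity of the state gives the inequality,
  faithfulness the equality case.\<close>

lemma
  assumes a: "a \<in> M"
  shows gns_sq_map_le: "gns_sq (\<Phi> a) \<le> gns_sq a"
    and gns_sq_map_eq: "gns_sq (\<Phi> a) = gns_sq a \<Longrightarrow> \<Phi> (adj a o\<^sub>L a) = \<Phi> (adj a) o\<^sub>L \<Phi> a"
proof -
  define d where "d = \<Phi> (adj a o\<^sub>L a) - (\<Phi> (adj a) o\<^sub>L \<Phi> a)"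
  have d: "d \<in> M" "positive_op d"
    using fwd.map_schwarz(2)[OF a] by (simp_all add: d_def a closed fwd.map_closed)
  have \<phi>d: "\<phi> d = of_real (gns_sq a - gns_sq (\<Phi> a))"
    by (simp add: d_def state_diff a closed fwd.map_closed invariant state_square fwd.map_adj)
  then show "gns_sq (\<Phi> a) \<le> gns_sq a"
    using state_positive(2)[OF d] by simp
  show "\<Phi> (adj a o\<^sub>L a) = \<Phi> (adj a) o\<^sub>L \<Phi> a" if "gns_sq (\<Phi> a) = gns_sq a"
    using state_positive(3)[OF d] \<phi>d that by (simp add: d_def)
qed

lemma gns_sq_pow_le: "a \<in> M \<Longrightarrow> gns_sq ((\<Phi> ^^ n) a) \<le> gns_sq a"
  by (induction n) (auto intro: order_trans[OF gns_sq_map_le] simp: fwd.pow_closed)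

text \<open>The norm of \<open>\<Phi>\<^sup>n a\<close> does not drop under one more application of
  \<open>\<Phi>\<close>, so the equality case applies to it at each step of the induction.\<close>

lemma pow_multiplicative:
  assumes a: "a \<in> M" and eq: "\<And>n. gns_sq ((\<Phi> ^^ n) a) = gns_sq a"
  shows "(\<Phi> ^^ n) (adj a o\<^sub>L a) = (\<Phi> ^^ n) (adj a) o\<^sub>L (\<Phi> ^^ n) a"
proof (induction n)
  case (Suc n)
  have "gns_sq (\<Phi> ((\<Phi> ^^ n) a)) = gns_sq ((\<Phi> ^^ n) a)"
    using eq[of n] eq[of "Suc n"] by simp
  then show ?case
    using Suc gns_sq_map_eq[of "(\<Phi> ^^ n) a"] a by (simp add: fwd.pow_closed fwd.pow_adj)
qed simp

text \<open>The adjoint relation turns \<open>gns_sq (\<Phi>\<^sup>n a)\<close> into the real part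
  of \<open>\<phi> ((\<Phi>s\<^sup>n \<Phi>\<^sup>n a)\<^sup>* a)\<close>.\<close>

lemma gns_sq_pow_fixed:
  assumes a: "a \<in> M" and fixed: "(\<Phi>s ^^ n) ((\<Phi> ^^ n) a) = a"
  shows "gns_sq ((\<Phi> ^^ n) a) = gns_sq a"
proof -
  have "\<phi> (adj ((\<Phi> ^^ n) a) o\<^sub>L (\<Phi> ^^ n) a) = \<phi> ((\<Phi>s ^^ n) (adj ((\<Phi> ^^ n) a)) o\<^sub>L a)"
    by (rule pow_adjoint) (simp_all add: a closed fwd.pow_closed)
  also have "(\<Phi>s ^^ n) (adj ((\<Phi> ^^ n) a)) = adj a"
    by (simp add: bwd.pow_adj fwd.pow_closed a fixed)
  finally show ?thesis
    by (simp add: gns_sq_def)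
qed

text \<open>The fixed-point property passes to \<open>adj a\<close>; the Schwarz equalities for
  \<open>a\<close> and \<open>adj a\<close> are the two conditions defining the multiplicative
  domain.\<close>

lemma pow_multiplicative_of_fixed:
  assumes a: "a \<in> M" and fixed: "\<And>n. (\<Phi>s ^^ n) ((\<Phi> ^^ n) a) = a"
  shows "a \<in> multiplicative_domain M (\<Phi> ^^ n)"
proof -
  have "(\<Phi>s ^^ n) ((\<Phi> ^^ n) (adj a)) = adj a" for n
    by (simp add: fwd.pow_adj bwd.pow_adj fwd.pow_closed a fixed)
  then have "(\<Phi> ^^ n) (adj (adj a) o\<^sub>L adj a) = (\<Phi> ^^ n) (adj (adj a)) o\<^sub>L (\<Phi> ^^ n) (adj a)"
    by (intro pow_multiplicative gns_sq_pow_fixed) (simp_all add: closed a)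
  moreover have "(\<Phi> ^^ n) (adj a o\<^sub>L a) = (\<Phi> ^^ n) (adj a) o\<^sub>L (\<Phi> ^^ n) a"
    by (intro pow_multiplicative gns_sq_pow_fixed a fixed)
  ultimately show ?thesis
    using a by (simp add: multiplicative_domain_def adj_adj ops)
qed

text \<open>On expanding the square, the cross term equals
  \<open>-2 gns_sq (\<Phi>\<^sup>n a)\<close> by the adjoint relation, while contractivity of
  \<open>\<Phi>s\<close> bounds the first term by \<open>gns_sq (\<Phi>\<^sup>n a)\<close>.\<close>

lemma gns_sq_defect_le:
  assumes a: "a \<in> M"
  shows "gns_sq ((\<Phi>s ^^ n) ((\<Phi> ^^ n) a) - a) \<le> gns_sq a - gns_sq ((\<Phi> ^^ n) a)"
proof -
  interpret sw: dynamical_pair M \<phi> \<Phi>s \<Phi>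
    by (rule swap)
  let ?b = "(\<Phi> ^^ n) a"
  have b: "?b \<in> M"
    by (simp add: a fwd.pow_closed)
  have "\<phi> (adj ((\<Phi>s ^^ n) ?b) o\<^sub>L a) = \<phi> ((\<Phi>s ^^ n) (adj ?b) o\<^sub>L a)"
    by (simp add: bwd.pow_adj b)
  also have "\<dots> = \<phi> (adj ?b o\<^sub>L ?b)"
    by (rule pow_adjoint[symmetric]) (simp_all add: a b closed)
  finally have "Re (\<phi> (adj ((\<Phi>s ^^ n) ?b) o\<^sub>L a)) = gns_sq ?b"
    by (simp add: gns_sq_def)
  then show ?thesis
    using gns_sq_diff[of "(\<Phi>s ^^ n) ?b" a] sw.gns_sq_pow_le[OF b, of n] a b
    by (simp add: bwd.pow_closed)
qed

text \<open>The sequence \<open>u n\<close> decreases and is nonnegative, hence converges; the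
  defect at \<open>\<Phi>\<^sup>n a\<close> is at most \<open>u n - u (n + k)\<close>.\<close>

lemma gns_sq_defect_tendsto:
  assumes a: "a \<in> M"
  shows "(\<lambda>n. gns_sq ((\<Phi>s ^^ k) ((\<Phi> ^^ k) ((\<Phi> ^^ n) a)) - (\<Phi> ^^ n) a)) \<longlonglongrightarrow> 0"
proof -
  define u where "u n = gns_sq ((\<Phi> ^^ n) a)" for n
  have "decseq u"
    using gns_sq_map_le[of "(\<Phi> ^^ n) a" for n] a by (intro decseq_SucI) (simp add: u_def fwd.pow_closed)
  then obtain l where l: "u \<longlonglongrightarrow> l"
    using decseq_convergent[of u 0] a by (auto simp: u_def state_square fwd.pow_closed)
  have "(\<lambda>n. u n - u (n + k)) \<longlonglongrightarrow> l - l"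
    by (intro tendsto_diff l LIMSEQ_ignore_initial_segment)
  then have lim: "(\<lambda>n. u n - u (n + k)) \<longlonglongrightarrow> 0"
    by simp
  have "norm (gns_sq ((\<Phi>s ^^ k) ((\<Phi> ^^ k) ((\<Phi> ^^ n) a)) - (\<Phi> ^^ n) a)) \<le> u n - u (n + k)" for n
    using gns_sq_defect_le[of "(\<Phi> ^^ n) a" k] a
    by (simp add: u_def fwd.pow_closed bwd.pow_closed closed state_square
        add.commute[of n k] funpow_add)
  then show ?thesis
    by (intro Lim_null_comparison[OF _ lim] always_eventually) blast
qed

text \<open>After a shift of the index by \<open>k\<close>, this defect is the image under
  \<open>\<Phi>\<^sup>k\<close> of the previous one, and \<open>\<Phi>\<^sup>k\<close> is a
  contraction.\<close>

lemma gns_sq_defect_tendsto':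
  assumes a: "a \<in> M"
  shows "(\<lambda>n. gns_sq ((\<Phi> ^^ k) ((\<Phi>s ^^ k) ((\<Phi> ^^ n) a)) - (\<Phi> ^^ n) a)) \<longlonglongrightarrow> 0"
proof (rule LIMSEQ_offset[where k = k])
  have "gns_sq ((\<Phi> ^^ k) ((\<Phi>s ^^ k) ((\<Phi> ^^ (n + k)) a)) - (\<Phi> ^^ (n + k)) a)
      \<le> gns_sq ((\<Phi>s ^^ k) ((\<Phi> ^^ k) ((\<Phi> ^^ n) a)) - (\<Phi> ^^ n) a)" for n
    using gns_sq_pow_le[of "(\<Phi>s ^^ k) ((\<Phi> ^^ k) ((\<Phi> ^^ n) a)) - (\<Phi> ^^ n) a" k] a
    by (simp add: fwd.pow_diff fwd.pow_closed bwd.pow_closed closed add.commute[of n k] funpow_add)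
  then show "(\<lambda>n. gns_sq ((\<Phi> ^^ k) ((\<Phi>s ^^ k) ((\<Phi> ^^ (n + k)) a)) - (\<Phi> ^^ (n + k)) a)) \<longlonglongrightarrow> 0"
    using a
    by (intro Lim_null_comparison[OF _ gns_sq_defect_tendsto[OF a, of k]] always_eventually)
      (simp add: state_square fwd.pow_closed bwd.pow_closed closed)
qed

text \<open>Faithfulness of the state identifies limits that agree in all matrix elements
  \<open>\<phi> (c\<^sup>* \<cdot>)\<close>.\<close>

lemma bounded_wot_limit_eqI_gns:
  assumes f: "bounded_wot_limit f b G" and g: "bounded_wot_limit g c G" and G: "G \<noteq> bot"
    and M: "\<And>i. f i \<in> M" "\<And>i. g i \<in> M"
    and lim: "((\<lambda>i. gns_sq (g i - f i)) \<longlongrightarrow> 0) G"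
  shows "c = b"
proof -
  have b: "b \<in> M" and c: "c \<in> M"
    using f g G M bounded_wot_limit_closed by blast+
  define d where "d = c - b"
  have d: "d \<in> M"
    by (simp add: d_def closed b c)
  \<comment> \<open>Pairing with the difference \<open>d\<close> of the limits makes the limit
    \<open>\<phi> (d\<^sup>* d)\<close>, while Cauchy-Schwarz forces it to be 0.\<close>
  have "((\<lambda>i. \<phi> (adj d o\<^sub>L g i) - \<phi> (adj d o\<^sub>L f i)) \<longlongrightarrow> \<phi> (adj d o\<^sub>L c) - \<phi> (adj d o\<^sub>L b)) G"
    by (intro tendsto_diff predual_tendsto[OF predual] bounded_wot_limit_compose_left f g)
      (auto simp: closed d M b c)
  then have "((\<lambda>i. \<phi> (adj d o\<^sub>L (g i - f i))) \<longlongrightarrow> \<phi> (adj d o\<^sub>L d)) G"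
    using d b c M
    by (simp add: blinfun_compose_diff_right state_diff closed d_def)
  moreover have "((\<lambda>i. \<phi> (adj d o\<^sub>L (g i - f i))) \<longlongrightarrow> 0) G"
  proof (rule Lim_null_comparison)
    show "\<forall>\<^sub>F i in G. norm (\<phi> (adj d o\<^sub>L (g i - f i))) \<le> sqrt (gns_sq d * gns_sq (g i - f i))"
      by (intro always_eventually allI real_le_rsqrt gns_cauchy_schwarz closed d M)
    show "((\<lambda>i. sqrt (gns_sq d * gns_sq (g i - f i))) \<longlongrightarrow> 0) G"
      using tendsto_real_sqrt[OF tendsto_mult_right_zero[OF lim]] by simp
  qed
  ultimately have "\<phi> (adj d o\<^sub>L d) = 0"
    using G tendsto_unique by blast
  then have "d = 0"
    using gns_sq_eq_0[OF d] by (simp add: gns_sq_def)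
  then show ?thesis
    by (simp add: d_def)
qed

text \<open>The orbit and its images under \<open>\<Phi>s\<^sup>k \<Phi>\<^sup>k\<close> and
  \<open>\<Phi>\<^sup>k \<Phi>s\<^sup>k\<close> become GNS-close, so their limits along
  \<open>G\<close> coincide and \<open>b\<close> is fixed by both products.\<close>

lemma cluster_point_in_D_infinity:
  assumes a: "a \<in> M" and b: "bounded_wot_limit (\<lambda>n. (\<Phi> ^^ n) a) b G"
    and G: "G \<le> sequentially" "G \<noteq> bot"
  shows "b \<in> D_infinity M \<Phi> \<Phi>s"
proof -
  interpret sw: dynamical_pair M \<phi> \<Phi>s \<Phi>
    by (rule swap)
  have M: "(\<Phi> ^^ n) a \<in> M" "b \<in> M" for n
    using bounded_wot_limit_closed[OF b G(2)] a fwd.pow_closed by blast+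
  have 1: "(\<Phi>s ^^ k) ((\<Phi> ^^ k) b) = b" for k
    by (rule bounded_wot_limit_eqI_gns[OF b _ G(2) M(1) _
          tendsto_mono[OF G(1) gns_sq_defect_tendsto[OF a, of k]]])
      (intro bwd.bounded_wot_limit_pow fwd.bounded_wot_limit_pow b M fwd.pow_closed bwd.pow_closed)+
  have 2: "(\<Phi> ^^ k) ((\<Phi>s ^^ k) b) = b" for k
    by (rule bounded_wot_limit_eqI_gns[OF b _ G(2) M(1) _
          tendsto_mono[OF G(1) gns_sq_defect_tendsto'[OF a, of k]]])
      (intro bwd.bounded_wot_limit_pow fwd.bounded_wot_limit_pow b M fwd.pow_closed bwd.pow_closed)+
  have "b \<in> multiplicative_domain M (\<Phi> ^^ n)" "b \<in> multiplicative_domain M (\<Phi>s ^^ n)" for n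
    using pow_multiplicative_of_fixed[OF M(2) 1] sw.pow_multiplicative_of_fixed[OF M(2) 2] by blast+
  then show ?thesis
    by (simp add: D_infinity_def int_iterate_def)
qed

text \<open>Stated for functionals that are continuous along bounded weak limits, so as to cover both
  the predual and the functionals \<open>\<phi> (a \<cdot>)\<close>.\<close>

lemma functional_tendsto:
  assumes D: "D_infinity M \<Phi> \<Phi>s = {c *\<^sub>C id_blinfun | c. True}" and a: "a \<in> M"
    and \<omega>: "\<And>f b F. bounded_wot_limit f b (F :: nat filter) \<Longrightarrow> (\<And>i. f i \<in> M) \<Longrightarrow> b \<in> M \<Longrightarrow>
      ((\<lambda>i. \<omega> (f i)) \<longlongrightarrow> \<omega> b) F"
  shows "(\<lambda>n. \<omega> ((\<Phi> ^^ n) a)) \<longlonglongrightarrow> (\<omega> (\<phi> a *\<^sub>C id_blinfun) :: complex)"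
proof (rule ccontr)
  assume "\<not> ?thesis"
  then obtain S where S: "open S" "\<omega> (\<phi> a *\<^sub>C id_blinfun) \<in> S"
    and freq: "\<not> (\<forall>\<^sub>F n in sequentially. \<omega> ((\<Phi> ^^ n) a) \<in> S)"
    unfolding tendsto_def by blast
  \<comment> \<open>Only the indices at which the functional lies outside \<open>S\<close> are kept;
    a cluster point along them must differ from the expected limit.\<close>
  define F where "F = inf sequentially (principal {n. \<omega> ((\<Phi> ^^ n) a) \<notin> S})"
  have "F \<noteq> bot"
    using freq by (simp add: F_def trivial_limit_def eventually_inf_principal)
  then obtain G b where G: "G \<le> F" "G \<noteq> bot" and b: "bounded_wot_limit (\<lambda>n. (\<Phi> ^^ n) a) b G"
    using bounded_wot_cluster_point[of "\<lambda>n. (\<Phi> ^^ n) a" "norm a" F] fwd.norm_pow_le[OF a]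
      fwd.pow_closed[OF a] ops by blast
  have M: "(\<Phi> ^^ n) a \<in> M" "b \<in> M" for n
    using bounded_wot_limit_closed[OF b G(2)] a fwd.pow_closed by blast+
  have "G \<le> sequentially"
    using G(1) by (simp add: F_def)
  then have "b \<in> D_infinity M \<Phi> \<Phi>s"
    using cluster_point_in_D_infinity a b G by blast
  then obtain c where c: "b = c *\<^sub>C id_blinfun"
    using D by blast
  \<comment> \<open>Invariance of the state along the orbit identifies the scalar
    \<open>c\<close>.\<close>
  have "((\<lambda>n. \<phi> ((\<Phi> ^^ n) a)) \<longlongrightarrow> \<phi> b) G"
    by (rule predual_tendsto[OF predual b M])
  then have "\<phi> b = \<phi> a"
    using tendsto_unique[OF G(2) _ tendsto_const] by (simp add: pow_invariant a)
  then have "c = \<phi> a"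
    by (simp add: c state_smult id_closed state_id)
  then have "\<forall>\<^sub>F n in G. \<omega> ((\<Phi> ^^ n) a) \<in> S"
    using topological_tendstoD[OF \<omega>[OF b M] S(1)] S(2) c by simp
  moreover have "\<forall>\<^sub>F n in G. \<omega> ((\<Phi> ^^ n) a) \<notin> S"
    using G(1) by (rule filter_leD) (simp add: F_def eventually_inf_principal)
  ultimately have "\<forall>\<^sub>F n in G. False"
    by eventually_elim blast
  then show False
    using G(2) by (simp add: trivial_limit_def)
qed

end

section \<open>Cesaro means and the two limit statements\<close>

lemma cesaro_tendsto_zero:
  fixes u :: "nat \<Rightarrow> 'v::real_normed_field"
  assumes u: "u \<longlonglongrightarrow> 0"
  shows "(\<lambda>N. 1 / (of_nat N + 1) * (\<Sum>k=0..N. u k)) \<longlonglongrightarrow> 0"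
proof (rule LIMSEQ_I)
  fix e :: real assume e: "0 < e"
  obtain K where K: "\<And>n. n \<ge> K \<Longrightarrow> norm (u n) < e / 2"
    using LIMSEQ_D[OF u, of "e / 2"] e by auto
  define B where "B = (\<Sum>k<K. norm (u k))"
  \<comment> \<open>Beyond \<open>L\<close> the fixed contribution \<open>B\<close> of the first
    \<open>K\<close> terms is less than \<open>e / 2\<close> after division by \<open>N + 1\<close>;
    the remaining terms average to at most \<open>e / 2\<close>.\<close>
  obtain L where L: "2 * B / e < real L"
    using reals_Archimedean2 by blast
  have "norm (1 / (of_nat N + 1) * (\<Sum>k=0..N. u k) - 0) < e" if N: "N \<ge> max K L" for N
  proof -
    have "norm (\<Sum>k=0..N. u k) \<le> (\<Sum>k=0..N. norm (u k))"
      by (rule norm_sum)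
    also have "(\<Sum>k=0..N. norm (u k)) = B + (\<Sum>k=K..N. norm (u k))"
    proof -
      have "{0..N} = {..<K} \<union> {K..N}"
        using N by auto
      then show ?thesis
        unfolding B_def by (simp only:) (rule sum.union_disjoint; auto)
    qed
    also have "(\<Sum>k=K..N. norm (u k)) \<le> real (card {K..N}) * (e / 2)"
      by (rule sum_bounded_above) (use K in \<open>auto intro: less_imp_le\<close>)
    also have "real (card {K..N}) * (e / 2) \<le> real (N + 1) * (e / 2)"
      using e by (intro mult_right_mono) auto
    finally have 1: "norm (\<Sum>k=0..N. u k) \<le> B + real (N + 1) * (e / 2)"
      by simp
    have "2 * B / e < real (N + 1)"
      using L N by linarith
    then have "B < real (N + 1) * (e / 2)"
      using e by (simp add: field_simps)
    with 1 have "norm (\<Sum>k=0..N. u k) < real (N + 1) * e"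
      by (simp add: field_simps)
    moreover have "norm (of_nat N + 1 :: 'v) = real (N + 1)"
      by (metis norm_of_nat of_nat_Suc Suc_eq_plus1 add.commute)
    ultimately show ?thesis
      by (simp add: norm_mult norm_divide divide_less_eq mult.commute)
  qed
  then show "\<exists>no. \<forall>n\<ge>no. norm (1 / (of_nat n + 1) * (\<Sum>k=0..n. u k) - 0) < e"
    by blast
qed

theorem proposition15:
  fixes M :: "('h::chilbert_space \<Rightarrow>\<^sub>L 'h) set"
    and \<Phi> \<Phi>s :: "('h \<Rightarrow>\<^sub>L 'h) \<Rightarrow> ('h \<Rightarrow>\<^sub>L 'h)"
    and \<phi> :: "('h \<Rightarrow>\<^sub>L 'h) \<Rightarrow> complex"
  assumes "quantum_dynamical_system M \<Phi> \<phi>"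
    and "is_state_adjoint M \<phi> \<Phi> \<Phi>s"
    and "D_infinity M \<Phi> \<Phi>s = {c *\<^sub>C id_blinfun | c. True}"
  shows "asymptotic_equilibrium M \<Phi> \<phi> \<and> ergodic M \<Phi> \<phi>"
proof
  interpret dynamical_pair M \<phi> \<Phi> \<Phi>s
    using assms(1,2)
    by unfold_locales (auto simp: quantum_dynamical_system_def is_state_adjoint_def)
  note lim = functional_tendsto[OF assms(3)]
  show "asymptotic_equilibrium M \<Phi> \<phi>"
    unfolding asymptotic_equilibrium_def
  proof (intro ballI)
    fix a \<omega> assume a: "a \<in> M" and \<omega>: "\<omega> \<in> predual M"
    have "(\<lambda>n. \<omega> ((\<Phi> ^^ n) a)) \<longlonglongrightarrow> \<omega> (\<phi> a *\<^sub>C id_blinfun)"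
      by (rule lim[OF a]) (rule predual_tendsto[OF \<omega>])
    then show "(\<lambda>n. \<omega> ((\<Phi> ^^ n) a)) \<longlonglongrightarrow> \<omega> id_blinfun * \<phi> a"
      using \<omega> id_closed by (simp add: predual_def mult.commute)
  qed
  show "ergodic M \<Phi> \<phi>"
    unfolding ergodic_def
  proof (intro ballI cesaro_tendsto_zero)
    fix a b assume M: "a \<in> M" "b \<in> M"
    \<comment> \<open>Left multiplication preserves bounded weak limits, so
      \<open>\<phi> (a \<cdot>)\<close> is an admissible functional. The correlations thus converge
      even without averaging.\<close>
    have "(\<lambda>n. \<phi> (a o\<^sub>L (\<Phi> ^^ n) b)) \<longlonglongrightarrow> \<phi> (a o\<^sub>L (\<phi> b *\<^sub>C id_blinfun))"
      by (rule lim[OF M(2)], rule predual_tendsto[OF predual])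
        (simp_all add: M closed bounded_wot_limit_compose_left ops)
    also have "\<phi> (a o\<^sub>L (\<phi> b *\<^sub>C id_blinfun)) = \<phi> a * \<phi> b"
      by (simp add: blinfun_compose_scaleC_right ops M state_smult)
    finally show "(\<lambda>n. \<phi> (a o\<^sub>L (\<Phi> ^^ n) b) - \<phi> a * \<phi> b) \<longlonglongrightarrow> 0"
      by (simp add: LIM_zero)
  qed
qed

end
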